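(* Let $V(x)=\sup_{\tau\in\mathcal{S}}E\left[\int_0^\tau e^{-rs}\Pi(X(s))\,ds\right]$ be the value function of the original optimal stopping problem and, for $C>0$, let $V_C(x)=\sup_{\tau\in\mathcal{S}}E\left[\int_0^\tau e^{-rs}\Pi(X^C(s))\,ds\right]$ be the value function of the truncated problem, with $X(0)=x$ in both cases and $X$, $X^C$, $\Pi$ as described in the context. Then $V_C$ converges to $V$ as $C\to+\infty$, that is, $\lim_{C\to+\infty}V_C(x)=V(x)$ for every $x\ge 0$.
   Context: Parameters: $\alpha\in\mathbb{R}$, $\sigma>0$, $\gamma>0$, $r>0$ (constant interest rate), $K>0$ (fixed cost), with the standing assumption $r>\sigma^2+2\alpha$. On a complete filtered probability space $(\Omega,\{\mathcal{F}_t\}_{t\ge0},\mathcal{P})$ let $W$ be a Brownian motion and let $X=\{X(t),t\ge 0\}$ be the geometric Brownian motion $dX(t)=\alpha X(t)\,dt+\sigma X(t)\,dW(t)$, $X(0)=x\ge0$. The profit function is $\Pi(x)=\frac{\gamma^2x^2}{4}-K$. $\mathcal{S}$ denotes the set of all Markov (stopping) times with respect to $\{\mathcal{F}_t\}$ with values in $[0,+\infty]$. For $C\in(0,+\infty)$ let $\nu_C=\inf\{t: X(t)\ge C\}$ (with $\inf\emptyset=+\infty$), and define the truncated process by $X^C(t)=X(t)$ if $t<\nu_C$ and $X^C(t)=0$ if $t\ge\nu_C$. Expectations are conditional on $X(0)=x$. *)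

theory Defs
  imports "HOL-Probability.Probability"
begin

text \<open>
  Time runs through \<open>[0, \<infinity>]\<close>, so that the library's stopping times may take the value
  \<open>\<infinity>\<close>. The \<open>\<sigma>\<close>-algebra at \<open>\<infinity>\<close> is irrelevant for the notion of stopping time, since
  \<open>{\<tau> \<le> \<infinity>}\<close> is the whole space. Completeness means that the measure is complete and that all
  null sets belong to the initial \<open>\<sigma>\<close>-algebra; right-continuity is not required.
\<close>

locale complete_filtered_prob_space =
  prob_space M + complete_measure M + filtration "space M" F
  for M :: "'a measure" and F :: "ennreal \<Rightarrow> 'a measure" +
  assumes subalgebra_F: "\<And>t. subalgebra M (F t)"
    and null_sets_F: "null_sets M \<subseteq> sets (F 0)"

definition adapted :: "(ennreal \<Rightarrow> 'a measure) \<Rightarrow> (real \<Rightarrow> 'a \<Rightarrow> real) \<Rightarrow> bool" where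
  "adapted F X \<longleftrightarrow> (\<forall>t\<ge>0. X t \<in> borel_measurable (F (ennreal t)))"

definition brownian_motion ::
  "'a measure \<Rightarrow> (ennreal \<Rightarrow> 'a measure) \<Rightarrow> (real \<Rightarrow> 'a \<Rightarrow> real) \<Rightarrow> bool" where
  "brownian_motion M F W \<longleftrightarrow>
     adapted F W \<and>
     (AE \<omega> in M. W 0 \<omega> = 0) \<and>
     (AE \<omega> in M. continuous_on {0..} (\<lambda>t. W t \<omega>)) \<and>
     (\<forall>s t. 0 \<le> s \<and> s < t \<longrightarrow>
        distributed M lborel (\<lambda>\<omega>. W t \<omega> - W s \<omega>) (\<lambda>y. ennreal (normal_density 0 (sqrt (t - s)) y)) \<and>
        prob_space.indep_set M (sets (F (ennreal s)))
          {(\<lambda>\<omega>. W t \<omega> - W s \<omega>) -` B \<inter> space M | B. B \<in> sets borel})"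

text \<open>
  The \<open>L\<^sup>2\<close> theory of the Ito integral. An elementary process is given by a partition
  \<open>p 0 \<le> \<dots> \<le> p n\<close> and bounded weights \<open>\<xi> i\<close> that are measurable at time \<open>p i\<close>; it takes the
  value \<open>\<xi> i\<close> on \<open>(p i, p (i + 1)]\<close>.
\<close>

definition elementary ::
  "'a measure \<Rightarrow> (ennreal \<Rightarrow> 'a measure) \<Rightarrow> nat \<Rightarrow> (nat \<Rightarrow> real) \<Rightarrow> (nat \<Rightarrow> 'a \<Rightarrow> real) \<Rightarrow> bool" where
  "elementary M F n p \<xi> \<longleftrightarrow>
     0 \<le> p 0 \<and> (\<forall>i<n. p i \<le> p (Suc i)) \<and>
     (\<forall>i<n. \<xi> i \<in> borel_measurable (F (ennreal (p i))) \<and> (\<exists>B. \<forall>\<omega>\<in>space M. \<bar>\<xi> i \<omega>\<bar> \<le> B))"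

definition elementary_process ::
  "nat \<Rightarrow> (nat \<Rightarrow> real) \<Rightarrow> (nat \<Rightarrow> 'a \<Rightarrow> real) \<Rightarrow> real \<Rightarrow> 'a \<Rightarrow> real" where
  "elementary_process n p \<xi> t \<omega> = (\<Sum>i<n. \<xi> i \<omega> * indicator {p i <.. p (Suc i)} t)"

definition elementary_integral ::
  "(real \<Rightarrow> 'a \<Rightarrow> real) \<Rightarrow> nat \<Rightarrow> (nat \<Rightarrow> real) \<Rightarrow> (nat \<Rightarrow> 'a \<Rightarrow> real) \<Rightarrow> real \<Rightarrow> 'a \<Rightarrow> real" where
  "elementary_integral W n p \<xi> T \<omega> =
     (\<Sum>i<n. \<xi> i \<omega> * (W (min (p (Suc i)) T) \<omega> - W (min (p i) T) \<omega>))"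

definition ito_integrand ::
  "'a measure \<Rightarrow> (ennreal \<Rightarrow> 'a measure) \<Rightarrow> (real \<Rightarrow> 'a \<Rightarrow> real) \<Rightarrow> real \<Rightarrow> bool" where
  "ito_integrand M F H T \<longleftrightarrow>
     adapted F H \<and>
     (\<lambda>(t, \<omega>). H t \<omega>) \<in> borel_measurable (restrict_space borel {0..T} \<Otimes>\<^sub>M M) \<and>
     (\<integral>\<^sup>+\<omega>. (\<integral>\<^sup>+t\<in>{0..T}. ennreal ((H t \<omega>)\<^sup>2) \<partial>lborel) \<partial>M) < \<infinity>"

text \<open>\<open>has_ito_integral M F W H T I\<close>: the random variable \<open>I\<close> is a version of \<open>\<integral>\<^sub>0\<^sup>T H dW\<close>.\<close>

definition has_ito_integral ::
  "'a measure \<Rightarrow> (ennreal \<Rightarrow> 'a measure) \<Rightarrow> (real \<Rightarrow> 'a \<Rightarrow> real) \<Rightarrow> (real \<Rightarrow> 'a \<Rightarrow> real) \<Rightarrow> real \<Rightarrow>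
   ('a \<Rightarrow> real) \<Rightarrow> bool" where
  "has_ito_integral M F W H T I \<longleftrightarrow>
     ito_integrand M F H T \<and> I \<in> borel_measurable M \<and>
     (\<exists>n p \<xi>. (\<forall>k::nat. elementary M F (n k) (p k) (\<xi> k)) \<and>
        (\<lambda>k. \<integral>\<^sup>+\<omega>. (\<integral>\<^sup>+t\<in>{0..T}.
            ennreal ((elementary_process (n k) (p k) (\<xi> k) t \<omega> - H t \<omega>)\<^sup>2) \<partial>lborel) \<partial>M) \<longlonglongrightarrow> 0 \<and>
        (\<lambda>k. \<integral>\<^sup>+\<omega>. ennreal ((elementary_integral W (n k) (p k) (\<xi> k) T \<omega> - I \<omega>)\<^sup>2) \<partial>M) \<longlonglongrightarrow> 0)"

text \<open>Strong solutions of \<open>dX(t) = b(X(t)) dt + a(X(t)) dW(t)\<close>, \<open>X(0) = x\<close>.\<close>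

definition sde_solution ::
  "'a measure \<Rightarrow> (ennreal \<Rightarrow> 'a measure) \<Rightarrow> (real \<Rightarrow> 'a \<Rightarrow> real) \<Rightarrow> (real \<Rightarrow> real) \<Rightarrow> (real \<Rightarrow> real) \<Rightarrow>
   real \<Rightarrow> (real \<Rightarrow> 'a \<Rightarrow> real) \<Rightarrow> bool" where
  "sde_solution M F W b a x X \<longleftrightarrow>
     adapted F X \<and>
     (AE \<omega> in M. X 0 \<omega> = x) \<and>
     (AE \<omega> in M. continuous_on {0..} (\<lambda>t. X t \<omega>)) \<and>
     (\<forall>T\<ge>0.
        (AE \<omega> in M. set_integrable lborel {0..T} (\<lambda>t. b (X t \<omega>))) \<and>
        (\<exists>I. has_ito_integral M F W (\<lambda>t \<omega>. a (X t \<omega>)) T I \<and>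
             (AE \<omega> in M. X T \<omega> = x + (LINT t:{0..T}|lborel. b (X t \<omega>)) + I \<omega>)))"

definition geometric_brownian_motion ::
  "'a measure \<Rightarrow> (ennreal \<Rightarrow> 'a measure) \<Rightarrow> (real \<Rightarrow> 'a \<Rightarrow> real) \<Rightarrow> real \<Rightarrow> real \<Rightarrow> real \<Rightarrow>
   (real \<Rightarrow> 'a \<Rightarrow> real) \<Rightarrow> bool" where
  "geometric_brownian_motion M F W \<alpha> \<sigma> x X \<longleftrightarrow>
     sde_solution M F W (\<lambda>y. \<alpha> * y) (\<lambda>y. \<sigma> * y) x X"

definition profit :: "real \<Rightarrow> real \<Rightarrow> real \<Rightarrow> real" where
  "profit \<gamma> K x = \<gamma>\<^sup>2 * x\<^sup>2 / 4 - K"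

definition hitting_time :: "(real \<Rightarrow> 'a \<Rightarrow> real) \<Rightarrow> real \<Rightarrow> 'a \<Rightarrow> ennreal" where
  "hitting_time X C \<omega> = Inf {ennreal t | t. 0 \<le> t \<and> X t \<omega> \<ge> C}"

definition truncated :: "(real \<Rightarrow> 'a \<Rightarrow> real) \<Rightarrow> real \<Rightarrow> real \<Rightarrow> 'a \<Rightarrow> real" where
  "truncated X C t \<omega> = (if ennreal t < hitting_time X C \<omega> then X t \<omega> else 0)"

text \<open>
  The supremum is taken in the extended reals. When \<open>r > \<sigma>\<^sup>2 + 2 * \<alpha>\<close> and \<open>r > 0\<close>, the discounted
  profit of a geometric Brownian motion, and of its truncations, is integrable over
  \<open>[0, \<infinity>)\<close> and the sample space jointly, so the Bochner integrals below are genuine ones.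
\<close>

definition stopping_value ::
  "'a measure \<Rightarrow> (ennreal \<Rightarrow> 'a measure) \<Rightarrow> real \<Rightarrow> (real \<Rightarrow> real) \<Rightarrow> (real \<Rightarrow> 'a \<Rightarrow> real) \<Rightarrow> ereal" where
  "stopping_value M F r P Y =
     (SUP \<tau>\<in>{\<tau>. stopping_time F \<tau>}.
        ereal (LINT \<omega>|M. (LINT s:{s. 0 \<le> s \<and> ennreal s \<le> \<tau> \<omega>}|lborel. exp (- r * s) * P (Y s \<omega>))))"

end

theory Submission
  imports Defs
begin

text \<open>
  Why the theorem holds: for a fixed stopping time, the truncated and the original problem differ by at
  most \<open>E \<integral>\<^sub>0\<^sup>\<infinity> e\<^bsup>-rs\<^esup> (\<gamma>\<^sup>2/4) X(s)\<^sup>2 1{s \<ge> \<nu>\<^sub>C} ds\<close>, a bound in which the stopping time no longer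
  occurs; hence the suprema differ by at most the same amount (\<open>SUP_uniform_limit\<close>). A
  continuous path is bounded on \<open>[0, s]\<close>, so \<open>\<nu>\<^sub>C > s\<close> as soon as \<open>C\<close> is large
  (\<open>truncated_eventually_eq\<close>), and the integrand tends to \<open>0\<close> pointwise. Dominated
  convergence on the product of time and sample space finishes the proof, provided that
  \<open>E \<integral>\<^sub>0\<^sup>\<infinity> e\<^bsup>-rs\<^esup> X(s)\<^sup>2 ds < \<infinity>\<close>. This follows from \<open>r > \<sigma>\<^sup>2 + 2\<alpha>\<close> and
  \<open>E X(t)\<^sup>2 = x\<^sup>2 e\<^bsup>(\<sigma>\<^sup>2+2\<alpha>)t\<^esup>\<close>.

  The second moment is computed straight from the integral equation. Write \<open>X(t) = N(t) + \<alpha>A(t)\<close> with \<open>A(t) = \<integral>\<^sub>0\<^sup>t X(s) ds\<close> and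
  \<open>N(t) = x + \<integral>\<^sub>0\<^sup>t \<sigma>X dW\<close>, and put \<open>m(t) = E X(t)\<^sup>2\<close> and \<open>b(t) = E X(t)A(t)\<close>. The isometry gives
  \<open>E N(t)\<^sup>2 = x\<^sup>2 + \<sigma>\<^sup>2 \<integral>\<^sub>0\<^sup>t m\<close>; the martingale property gives
  \<open>E A(t)N(t) = \<integral>\<^sub>0\<^sup>t E X(s)N(s) ds = \<integral>\<^sub>0\<^sup>t (m - \<alpha>b)\<close>; and \<open>A\<^sup>2 = 2 \<integral> XA\<close> pathwise. When the square
  of \<open>N(t) + \<alpha>A(t)\<close> is expanded, the terms with \<open>b\<close> cancel and
  \<open>m(t) = x\<^sup>2 + (\<sigma>\<^sup>2 + 2\<alpha>) \<integral>\<^sub>0\<^sup>t m\<close> remains, a linear equation with the stated solution.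

  The isometry (\<open>ito_isometry\<close>) and the martingale property (\<open>ito_integral_martingale\<close>) are limits
  of statements on elementary integrals. Integrals over unrelated partitions have to be compared,
  because the versions of the integral at two different times may come from different
  approximating sequences. The covariance formula \<open>stopped_increment_covariance\<close> for a pair of
  arbitrary intervals covers this case.
\<close>

section \<open>Square-integrable functions and product measures\<close>

definition square_integrable :: "'a measure \<Rightarrow> ('a \<Rightarrow> real) \<Rightarrow> bool" where
  "square_integrable M f \<longleftrightarrow> f \<in> borel_measurable M \<and> integrable M (\<lambda>x. (f x)\<^sup>2)"

lemma square_integrable_measurable: "square_integrable M f \<Longrightarrow> f \<in> borel_measurable M"
  by (simp add: square_integrable_def)

lemma square_integrableD: "square_integrable M f \<Longrightarrow> integrable M (\<lambda>x. (f x)\<^sup>2)"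
  by (simp add: square_integrable_def)

lemma square_integrable_iff_nn_integral:
  assumes "f \<in> borel_measurable M"
  shows "square_integrable M f \<longleftrightarrow> (\<integral>\<^sup>+x. ennreal ((f x)\<^sup>2) \<partial>M) < \<infinity>"
  using assms by (auto simp: square_integrable_def integrable_iff_bounded)

lemma square_integrable_mult_integrable:
  assumes "square_integrable M f" "square_integrable M g"
  shows "integrable M (\<lambda>x. f x * g x)"
proof (rule Bochner_Integration.integrable_bound)
  show "integrable M (\<lambda>x. (f x)\<^sup>2 + (g x)\<^sup>2)"
    using assms by (auto simp: square_integrable_def)
  show "(\<lambda>x. f x * g x) \<in> borel_measurable M"
    using assms by (auto simp: square_integrable_def)
  have "\<bar>a * b\<bar> \<le> a\<^sup>2 + b\<^sup>2" for a b :: real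
    using sum_squares_bound[of "\<bar>a\<bar>" "\<bar>b\<bar>"] abs_ge_zero[of "a * b"]
    unfolding abs_mult power2_abs by linarith
  then show "AE x in M. norm (f x * g x) \<le> norm ((f x)\<^sup>2 + (g x)\<^sup>2)"
    by simp
qed

lemma square_integrable_add:
  assumes "square_integrable M f" "square_integrable M g"
  shows "square_integrable M (\<lambda>x. f x + g x)"
  using assms square_integrable_mult_integrable[OF assms]
  by (auto simp: square_integrable_def power2_sum mult.assoc)

lemma square_integrable_cmult:
  "square_integrable M f \<Longrightarrow> square_integrable M (\<lambda>x. c * f x)"
  by (auto simp: square_integrable_def power_mult_distrib)

lemma square_integrable_diff:
  assumes "square_integrable M f" "square_integrable M g"
  shows "square_integrable M (\<lambda>x. f x - g x)"
  using square_integrable_add[OF assms(1) square_integrable_cmult[OF assms(2), of "-1"]] by simp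

lemma square_integrable_sum:
  "(\<And>i. i \<in> I \<Longrightarrow> square_integrable M (f i)) \<Longrightarrow> square_integrable M (\<lambda>x. \<Sum>i\<in>I. f i x)"
  by (induction I rule: infinite_finite_induct)
     (simp_all add: square_integrable_add, simp_all add: square_integrable_def)

lemma square_integrable_cong_AE:
  assumes "square_integrable M f" "g \<in> borel_measurable M" "AE x in M. f x = g x"
  shows "square_integrable M g"
proof -
  have "(\<integral>\<^sup>+x. ennreal ((f x)\<^sup>2) \<partial>M) = (\<integral>\<^sup>+x. ennreal ((g x)\<^sup>2) \<partial>M)"
    using assms(3) by (intro nn_integral_cong_AE) auto
  then show ?thesis
    using assms square_integrable_iff_nn_integral[of g M] square_integrable_iff_nn_integral[of f M]
    by (simp add: square_integrable_measurable)
qed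

lemma integral_square_diff:
  assumes "square_integrable M f" "square_integrable M g"
  shows "(\<integral>x. (f x - g x)\<^sup>2 \<partial>M) = (\<integral>x. (f x)\<^sup>2 \<partial>M) - 2 * (\<integral>x. f x * g x \<partial>M) + (\<integral>x. (g x)\<^sup>2 \<partial>M)"
proof -
  have "(\<integral>x. (f x - g x)\<^sup>2 \<partial>M) = (\<integral>x. (f x)\<^sup>2 + (g x)\<^sup>2 - 2 * (f x * g x) \<partial>M)"
    by (intro Bochner_Integration.integral_cong refl) (simp add: power2_diff mult.assoc)
  also have "\<dots> = (\<integral>x. (f x)\<^sup>2 + (g x)\<^sup>2 \<partial>M) - (\<integral>x. 2 * (f x * g x) \<partial>M)"
    using assms square_integrable_mult_integrable[OF assms]
    by (intro Bochner_Integration.integral_diff) (auto simp: square_integrable_def)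
  also have "(\<integral>x. (f x)\<^sup>2 + (g x)\<^sup>2 \<partial>M) = (\<integral>x. (f x)\<^sup>2 \<partial>M) + (\<integral>x. (g x)\<^sup>2 \<partial>M)"
    using assms by (intro Bochner_Integration.integral_add) (auto simp: square_integrable_def)
  finally show ?thesis by simp
qed

lemma integral_Cauchy_Schwarz:
  assumes f: "square_integrable M f" and g: "square_integrable M g"
  shows "(\<integral>x. f x * g x \<partial>M)\<^sup>2 \<le> (\<integral>x. (f x)\<^sup>2 \<partial>M) * (\<integral>x. (g x)\<^sup>2 \<partial>M)"
proof -
  define a b c where "a = (\<integral>x. (f x)\<^sup>2 \<partial>M)" and "b = (\<integral>x. f x * g x \<partial>M)" and "c = (\<integral>x. (g x)\<^sup>2 \<partial>M)"
  have pos: "0 \<le> s\<^sup>2 * a - 2 * s * t * b + t\<^sup>2 * c" for s t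
  proof -
    have "0 \<le> (\<integral>x. (s * f x - t * g x)\<^sup>2 \<partial>M)" by simp
    also have "\<dots> = (\<integral>x. s\<^sup>2 * (f x)\<^sup>2 \<partial>M) - 2 * (\<integral>x. (s * t) * (f x * g x) \<partial>M) + (\<integral>x. t\<^sup>2 * (g x)\<^sup>2 \<partial>M)"
      by (subst integral_square_diff[OF square_integrable_cmult[OF f] square_integrable_cmult[OF g]])
         (simp add: power_mult_distrib mult_ac)
    finally show ?thesis by (simp add: a_def b_def c_def)
  qed
  have c0: "c \<ge> 0" by (simp add: c_def)
  show ?thesis
  proof (cases "c = 0")
    case True
    have "b = 0"
    proof (rule ccontr)
      assume "b \<noteq> 0"
      then show False using pos[of 1 "(a + 1) / (2 * b)"] True by simp
    qed
    then show ?thesis using True by (simp add: a_def b_def c_def)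
  next
    case False
    have "0 \<le> c * (a * c - b\<^sup>2)"
      using pos[of c b] by (simp add: algebra_simps power2_eq_square)
    then have "b\<^sup>2 \<le> a * c" using False c0 by (simp add: zero_le_mult_iff)
    then show ?thesis by (simp add: a_def b_def c_def)
  qed
qed

lemma square_integrable_limit:
  assumes "\<And>k::nat. square_integrable M (f k)" "g \<in> borel_measurable M"
    and lim: "(\<lambda>k. \<integral>\<^sup>+x. ennreal ((f k x - g x)\<^sup>2) \<partial>M) \<longlonglongrightarrow> 0"
  shows "square_integrable M g"
proof -
  have "\<forall>\<^sub>F k in sequentially. (\<integral>\<^sup>+x. ennreal ((f k x - g x)\<^sup>2) \<partial>M) < \<infinity>"
    by (rule order_tendstoD(2)[OF lim]) simp
  then obtain k where k: "(\<integral>\<^sup>+x. ennreal ((f k x - g x)\<^sup>2) \<partial>M) < \<infinity>"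
    by (auto simp: eventually_sequentially)
  have fk: "f k \<in> borel_measurable M" using assms(1) by (rule square_integrable_measurable)
  from k have "square_integrable M (\<lambda>x. f k x - g x)"
    using fk assms(2) by (subst square_integrable_iff_nn_integral) auto
  from square_integrable_diff[OF assms(1)[of k] this] show ?thesis by simp
qed

lemma nn_integral_square_eq:
  "square_integrable M f \<Longrightarrow> (\<integral>\<^sup>+x. ennreal ((f x)\<^sup>2) \<partial>M) = ennreal (\<integral>x. (f x)\<^sup>2 \<partial>M)"
  by (intro nn_integral_eq_integral) (auto simp: square_integrable_def)

text \<open>
  The approximation of Ito integrals is phrased with nonnegative integrals, whereas inner products need
  Bochner integrals; this passes from one to the other.
\<close>

lemma square_limit_real_iff:
  assumes "\<And>k::nat. square_integrable M (f k)" "square_integrable M g"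
  shows "(\<lambda>k. \<integral>\<^sup>+x. ennreal ((f k x - g x)\<^sup>2) \<partial>M) \<longlonglongrightarrow> 0 \<longleftrightarrow> (\<lambda>k. \<integral>x. (f k x - g x)\<^sup>2 \<partial>M) \<longlonglongrightarrow> 0"
  by (subst nn_integral_square_eq[OF square_integrable_diff[OF assms]])
     (simp flip: ennreal_0)

text \<open>
  Strong convergence in \<open>L\<^sup>2\<close> implies weak convergence, by the Cauchy-Schwarz inequality.
\<close>

lemma integral_mult_limit:
  assumes f: "\<And>k::nat. square_integrable M (f k)" and g: "square_integrable M g"
    and Z: "square_integrable M Z"
    and lim: "(\<lambda>k. \<integral>x. (f k x - g x)\<^sup>2 \<partial>M) \<longlonglongrightarrow> 0"
  shows "(\<lambda>k. \<integral>x. Z x * f k x \<partial>M) \<longlonglongrightarrow> (\<integral>x. Z x * g x \<partial>M)"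
proof -
  have le: "\<bar>(\<integral>x. Z x * f k x \<partial>M) - (\<integral>x. Z x * g x \<partial>M)\<bar>
      \<le> sqrt ((\<integral>x. (Z x)\<^sup>2 \<partial>M) * (\<integral>x. (f k x - g x)\<^sup>2 \<partial>M))" for k
  proof -
    have "(\<integral>x. Z x * f k x \<partial>M) - (\<integral>x. Z x * g x \<partial>M) = (\<integral>x. Z x * (f k x - g x) \<partial>M)"
      by (subst Bochner_Integration.integral_diff[symmetric])
         (auto intro: square_integrable_mult_integrable f g Z simp: algebra_simps)
    then show ?thesis
      using integral_Cauchy_Schwarz[OF Z square_integrable_diff[OF f[of k] g]]
      by (simp add: real_le_rsqrt)
  qed
  have "(\<lambda>k. sqrt ((\<integral>x. (Z x)\<^sup>2 \<partial>M) * (\<integral>x. (f k x - g x)\<^sup>2 \<partial>M))) \<longlonglongrightarrow> sqrt ((\<integral>x. (Z x)\<^sup>2 \<partial>M) * 0)"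
    by (intro tendsto_intros lim)
  then have lim0: "(\<lambda>k. sqrt ((\<integral>x. (Z x)\<^sup>2 \<partial>M) * (\<integral>x. (f k x - g x)\<^sup>2 \<partial>M))) \<longlonglongrightarrow> 0"
    by simp
  have "(\<lambda>k. (\<integral>x. Z x * f k x \<partial>M) - (\<integral>x. Z x * g x \<partial>M)) \<longlonglongrightarrow> 0"
    by (rule Lim_null_comparison[OF always_eventually lim0]) (auto intro: le)
  then show ?thesis by (simp add: LIM_zero_iff)
qed

text \<open>
  Expand \<open>f\<^sup>2 = (f - g)\<^sup>2 + 2fg - g\<^sup>2\<close>: the first term vanishes in the limit and the second converges
  weakly.
\<close>

lemma integral_square_limit:
  assumes f: "\<And>k::nat. square_integrable M (f k)" and g: "square_integrable M g"
    and lim: "(\<lambda>k. \<integral>x. (f k x - g x)\<^sup>2 \<partial>M) \<longlonglongrightarrow> 0"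
  shows "(\<lambda>k. \<integral>x. (f k x)\<^sup>2 \<partial>M) \<longlonglongrightarrow> (\<integral>x. (g x)\<^sup>2 \<partial>M)"
proof -
  have "(\<integral>x. (f k x)\<^sup>2 \<partial>M) = (\<integral>x. (f k x - g x)\<^sup>2 \<partial>M) + 2 * (\<integral>x. g x * f k x \<partial>M) - (\<integral>x. (g x)\<^sup>2 \<partial>M)" for k
    using integral_square_diff[OF f[of k] g] by (simp add: mult.commute)
  moreover have "(\<lambda>k. (\<integral>x. (f k x - g x)\<^sup>2 \<partial>M) + 2 * (\<integral>x. g x * f k x \<partial>M) - (\<integral>x. (g x)\<^sup>2 \<partial>M))
      \<longlonglongrightarrow> 0 + 2 * (\<integral>x. g x * g x \<partial>M) - (\<integral>x. (g x)\<^sup>2 \<partial>M)"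
    by (intro tendsto_intros lim integral_mult_limit[OF f g g lim])
  ultimately show ?thesis by (simp add: power2_eq_square)
qed

text \<open>
  The parallelogram inequality \<open>(a + b)\<^sup>2 \<le> 2a\<^sup>2 + 2b\<^sup>2\<close> serves as the triangle inequality for squared
  \<open>L\<^sup>2\<close> distances.
\<close>

lemma integral_square_diff_le:
  assumes "square_integrable M f" "square_integrable M g" "square_integrable M h"
  shows "(\<integral>x. (f x - h x)\<^sup>2 \<partial>M) \<le> 2 * (\<integral>x. (f x - g x)\<^sup>2 \<partial>M) + 2 * (\<integral>x. (g x - h x)\<^sup>2 \<partial>M)"
proof -
  note d = assms[THEN square_integrableD] square_integrable_diff[OF assms(1,2), THEN square_integrableD]
    square_integrable_diff[OF assms(2,3), THEN square_integrableD]
    square_integrable_diff[OF assms(1,3), THEN square_integrableD]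
  have "(\<integral>x. (f x - h x)\<^sup>2 \<partial>M) \<le> (\<integral>x. 2 * (f x - g x)\<^sup>2 + 2 * (g x - h x)\<^sup>2 \<partial>M)"
  proof (rule integral_mono)
    fix x
    have "(f x - h x)\<^sup>2 \<le> (f x - h x)\<^sup>2 + ((f x - g x) - (g x - h x))\<^sup>2" by simp
    also have "\<dots> = 2 * (f x - g x)\<^sup>2 + 2 * (g x - h x)\<^sup>2"
      by (simp add: power2_eq_square algebra_simps)
    finally show "(f x - h x)\<^sup>2 \<le> 2 * (f x - g x)\<^sup>2 + 2 * (g x - h x)\<^sup>2" .
  qed (use d in auto)
  also have "\<dots> = 2 * (\<integral>x. (f x - g x)\<^sup>2 \<partial>M) + 2 * (\<integral>x. (g x - h x)\<^sup>2 \<partial>M)"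
    using d by simp
  finally show ?thesis .
qed

lemma square_integrable_bounded_mult:
  assumes f: "square_integrable M f" and g: "g \<in> borel_measurable M"
    and B: "\<And>x. x \<in> space M \<Longrightarrow> \<bar>g x\<bar> \<le> B"
  shows "square_integrable M (\<lambda>x. g x * f x)"
  unfolding square_integrable_def
proof
  have [measurable]: "f \<in> borel_measurable M" "g \<in> borel_measurable M"
    using f g by (auto simp: square_integrable_def)
  show "(\<lambda>x. g x * f x) \<in> borel_measurable M" by simp
  show "integrable M (\<lambda>x. (g x * f x)\<^sup>2)"
  proof (rule Bochner_Integration.integrable_bound)
    show "integrable M (\<lambda>x. B\<^sup>2 * (f x)\<^sup>2)" using f by (simp add: square_integrable_def)
    show "AE x in M. norm ((g x * f x)\<^sup>2) \<le> norm (B\<^sup>2 * (f x)\<^sup>2)"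
    proof (rule AE_I2)
      fix x assume "x \<in> space M"
      then have "(g x)\<^sup>2 \<le> B\<^sup>2" using power_mono[OF B, of x 2] by simp
      then show "norm ((g x * f x)\<^sup>2) \<le> norm (B\<^sup>2 * (f x)\<^sup>2)"
        by (simp add: power_mult_distrib mult_right_mono)
    qed
  qed simp
qed

lemma integral_sum_mult_sum:
  assumes "\<And>i. i \<in> I \<Longrightarrow> square_integrable M (f i)" "\<And>j. j \<in> J \<Longrightarrow> square_integrable M (g j)"
  shows "(\<integral>x. (\<Sum>i\<in>I. f i x) * (\<Sum>j\<in>J. g j x) \<partial>M) = (\<Sum>i\<in>I. \<Sum>j\<in>J. \<integral>x. f i x * g j x \<partial>M)"
proof -
  have int: "integrable M (\<lambda>x. f i x * g j x)" if "i \<in> I" "j \<in> J" for i j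
    using that assms by (intro square_integrable_mult_integrable)
  have "(\<integral>x. (\<Sum>i\<in>I. f i x) * (\<Sum>j\<in>J. g j x) \<partial>M) = (\<integral>x. (\<Sum>i\<in>I. \<Sum>j\<in>J. f i x * g j x) \<partial>M)"
    by (simp add: sum_product)
  also have "\<dots> = (\<Sum>i\<in>I. \<integral>x. (\<Sum>j\<in>J. f i x * g j x) \<partial>M)"
    by (intro Bochner_Integration.integral_sum Bochner_Integration.integrable_sum int)
  also have "\<dots> = (\<Sum>i\<in>I. \<Sum>j\<in>J. \<integral>x. f i x * g j x \<partial>M)"
    by (intro sum.cong refl Bochner_Integration.integral_sum int)
  finally show ?thesis .
qed

lemma (in pair_sigma_finite)
  fixes f :: "'a \<Rightarrow> real" and g :: "'b \<Rightarrow> real"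
  assumes f: "integrable M1 f" and g: "integrable M2 g"
  shows integrable_pair_mult: "integrable (M1 \<Otimes>\<^sub>M M2) (\<lambda>(x, y). f x * g y)"
    and integral_pair_mult: "(\<integral>(x, y). f x * g y \<partial>(M1 \<Otimes>\<^sub>M M2)) = (\<integral>x. f x \<partial>M1) * (\<integral>y. g y \<partial>M2)"
proof -
  have [measurable]: "f \<in> borel_measurable M1" "g \<in> borel_measurable M2"
    using f g by auto
  show *: "integrable (M1 \<Otimes>\<^sub>M M2) (\<lambda>(x, y). f x * g y)"
  proof (rule Fubini_integrable)
    show "integrable M1 (\<lambda>x. \<integral>y. norm (case (x, y) of (x, y) \<Rightarrow> f x * g y) \<partial>M2)"
      using f by (simp add: abs_mult)
    show "AE x in M1. integrable M2 (\<lambda>y. case (x, y) of (x, y) \<Rightarrow> f x * g y)"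
      using g by simp
  qed measurable
  show "(\<integral>(x, y). f x * g y \<partial>(M1 \<Otimes>\<^sub>M M2)) = (\<integral>x. f x \<partial>M1) * (\<integral>y. g y \<partial>M2)"
    using integral_fst'[OF *] by simp
qed

lemma (in finite_measure) square_integrable_integrable: "square_integrable M f \<Longrightarrow> integrable M f"
  unfolding square_integrable_def by (elim conjE) (rule square_integrable_imp_integrable)

lemma (in pair_sigma_finite) integral_cong_AE_snd:
  fixes f g :: "'a \<times> 'b \<Rightarrow> real"
  assumes f: "integrable (M1 \<Otimes>\<^sub>M M2) f" and g: "integrable (M1 \<Otimes>\<^sub>M M2) g"
    and ae: "AE y in M2. \<forall>x. f (x, y) = g (x, y)"
  shows "integral\<^sup>L (M1 \<Otimes>\<^sub>M M2) f = integral\<^sup>L (M1 \<Otimes>\<^sub>M M2) g"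
proof -
  have "(\<integral>y. (\<integral>x. f (x, y) \<partial>M1) \<partial>M2) = (\<integral>y. (\<integral>x. g (x, y) \<partial>M1) \<partial>M2)"
  proof (rule integral_cong_AE)
    show "(\<lambda>y. \<integral>x. f (x, y) \<partial>M1) \<in> borel_measurable M2"
      using integrable_snd[of "curry f"] f by simp
    show "(\<lambda>y. \<integral>x. g (x, y) \<partial>M1) \<in> borel_measurable M2"
      using integrable_snd[of "curry g"] g by simp
    show "AE y in M2. (\<integral>x. f (x, y) \<partial>M1) = (\<integral>x. g (x, y) \<partial>M1)"
      using ae by eventually_elim simp
  qed
  then show ?thesis
    using integral_snd[of "curry f"] integral_snd[of "curry g"] f g by simp
qed

section \<open>Covariance of Brownian increments\<close>

context complete_filtered_prob_space
begin

sublocale time: pair_sigma_finite "lborel :: real measure" M ..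

end

locale brownian_filtration = complete_filtered_prob_space M F
  for M :: "'a measure" and F :: "ennreal \<Rightarrow> 'a measure" +
  fixes W :: "real \<Rightarrow> 'a \<Rightarrow> real"
  assumes brownian: "brownian_motion M F W"
begin

lemma F_measurable_imp_measurable: "f \<in> borel_measurable (F t) \<Longrightarrow> f \<in> borel_measurable M"
  using measurable_from_subalg[OF subalgebra_F] .

lemma F_measurable_mono:
  assumes "f \<in> borel_measurable (F (ennreal s))" "s \<le> t"
  shows "f \<in> borel_measurable (F (ennreal t))"
proof -
  have "subalgebra (F (ennreal t)) (F (ennreal s))"
    using sets_F_mono[OF ennreal_leI[OF assms(2)]] by (simp add: subalgebra_def space_F)
  then show ?thesis using assms(1) by (rule measurable_from_subalg)
qed

lemma brownian_measurable_F: "0 \<le> t \<Longrightarrow> W t \<in> borel_measurable (F (ennreal t))"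
  using brownian by (simp add: brownian_motion_def adapted_def)

lemma brownian_measurable: "0 \<le> t \<Longrightarrow> W t \<in> borel_measurable M"
  using brownian_measurable_F F_measurable_imp_measurable by blast

lemma increment_measurable: "0 \<le> s \<Longrightarrow> s \<le> t \<Longrightarrow> (\<lambda>\<omega>. W t \<omega> - W s \<omega>) \<in> borel_measurable M"
  using brownian_measurable[of s] brownian_measurable[of t] by simp

text \<open>
  The definition of Brownian motion gives independence of the increment from the whole \<open>\<sigma>\<close>-algebra at its
  left end; both set systems are stable under intersections, so independence extends to the
  generated \<open>\<sigma>\<close>-algebras that the library's notion of independent variables refers to.
\<close>

lemma increment_indep_var:
  assumes st: "0 \<le> s" "s < t" and Y: "Y \<in> borel_measurable (F (ennreal s))"
  shows "indep_var borel Y borel (\<lambda>\<omega>. W t \<omega> - W s \<omega>)"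
proof -
  let ?D = "\<lambda>\<omega>. W t \<omega> - W s \<omega>"
  let ?C = "{?D -` B \<inter> space M | B. B \<in> sets borel}"
  have ind: "indep_set (sets (F (ennreal s))) ?C"
    using brownian st by (simp add: brownian_motion_def)
  have "Int_stable ?C"
  proof (rule Int_stableI)
    fix a b assume "a \<in> ?C" "b \<in> ?C"
    then obtain A B where "A \<in> sets borel" "B \<in> sets borel" "a = ?D -` A \<inter> space M" "b = ?D -` B \<inter> space M"
      by blast
    then show "a \<inter> b \<in> ?C" by (intro CollectI exI[of _ "A \<inter> B"]) auto
  qed
  moreover have "Int_stable (sets (F (ennreal s)))" by (intro Int_stableI) auto
  ultimately have ind': "indep_set (sigma_sets (space M) (sets (F (ennreal s)))) (sigma_sets (space M) ?C)"
    using indep_set_sigma_sets[OF ind] by blast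
  have sub: "sigma_sets (space M) {Y -` A \<inter> space M | A. A \<in> sets borel}
      \<subseteq> sigma_sets (space M) (sets (F (ennreal s)))"
    using measurable_sets[OF Y] by (intro sigma_sets_mono') (auto simp: space_F)
  show ?thesis
    unfolding indep_var_eq
  proof (intro conjI)
    show "random_variable borel Y" using Y by (rule F_measurable_imp_measurable)
    show "random_variable borel ?D" using st by (intro increment_measurable) auto
    show "indep_set (sigma_sets (space M) {Y -` A \<inter> space M | A. A \<in> sets borel}) (sigma_sets (space M) ?C)"
      using ind' sub by (auto simp: indep_sets2_eq)
  qed
qed

lemma
  assumes "0 \<le> s" "s \<le> t"
  shows increment_square_integrable: "square_integrable M (\<lambda>\<omega>. W t \<omega> - W s \<omega>)"
    and increment_mean: "(\<integral>\<omega>. W t \<omega> - W s \<omega> \<partial>M) = 0"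
    and increment_variance: "(\<integral>\<omega>. (W t \<omega> - W s \<omega>)\<^sup>2 \<partial>M) = t - s"
proof -
  let ?D = "\<lambda>\<omega>. W t \<omega> - W s \<omega>"
  have "square_integrable M ?D \<and> (\<integral>\<omega>. ?D \<omega> \<partial>M) = 0 \<and> (\<integral>\<omega>. (?D \<omega>)\<^sup>2 \<partial>M) = t - s"
  proof (cases "s = t")
    case True
    then show ?thesis by (simp add: square_integrable_def)
  next
    case False
    then have lt: "s < t" using assms by simp
    have D: "distributed M lborel ?D (\<lambda>y. ennreal (normal_density 0 (sqrt (t - s)) y))"
      using brownian assms lt by (simp add: brownian_motion_def)
    have pos: "0 < sqrt (t - s)" using lt by simp
    have mean: "(\<integral>\<omega>. ?D \<omega> \<partial>M) = 0"
      using normal_distributed_expectation[OF pos D] .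
    have "integrable M (\<lambda>\<omega>. (?D \<omega>)\<^sup>2)"
      using integrable_normal_moment[OF pos, of 0 2] distributed_integrable[OF D, of "\<lambda>x. x\<^sup>2"] by simp
    moreover have "(\<integral>\<omega>. (?D \<omega>)\<^sup>2 \<partial>M) = t - s"
      using normal_distributed_variance[OF pos D, unfolded mean] lt by (simp only: diff_zero real_sqrt_pow2)
    ultimately show ?thesis
      using mean increment_measurable[OF assms] by (simp add: square_integrable_def)
  qed
  then show "square_integrable M ?D" "(\<integral>\<omega>. ?D \<omega> \<partial>M) = 0" "(\<integral>\<omega>. (?D \<omega>)\<^sup>2 \<partial>M) = t - s"
    by auto
qed

lemma
  assumes st: "0 \<le> s" "s \<le> t" and Y: "Y \<in> borel_measurable (F (ennreal s))" "integrable M Y"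
  shows increment_mult_integrable: "integrable M (\<lambda>\<omega>. Y \<omega> * (W t \<omega> - W s \<omega>))"
    and increment_orthogonal: "(\<integral>\<omega>. Y \<omega> * (W t \<omega> - W s \<omega>) \<partial>M) = 0"
    and increment_square_mult_integrable: "integrable M (\<lambda>\<omega>. Y \<omega> * (W t \<omega> - W s \<omega>)\<^sup>2)"
    and increment_square_mult: "(\<integral>\<omega>. Y \<omega> * (W t \<omega> - W s \<omega>)\<^sup>2 \<partial>M) = (\<integral>\<omega>. Y \<omega> \<partial>M) * (t - s)"
proof -
  let ?D = "\<lambda>\<omega>. W t \<omega> - W s \<omega>"
  have sq: "square_integrable M ?D" by (rule increment_square_integrable[OF st])
  have int: "integrable M ?D"
    using sq by (rule square_integrable_integrable)
  have "integrable M (\<lambda>\<omega>. Y \<omega> * ?D \<omega>) \<and> (\<integral>\<omega>. Y \<omega> * ?D \<omega> \<partial>M) = 0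
     \<and> integrable M (\<lambda>\<omega>. Y \<omega> * (?D \<omega>)\<^sup>2) \<and> (\<integral>\<omega>. Y \<omega> * (?D \<omega>)\<^sup>2 \<partial>M) = (\<integral>\<omega>. Y \<omega> \<partial>M) * (t - s)"
  proof (cases "s = t")
    case True
    then show ?thesis by simp
  next
    case False
    then have "s < t" using st by simp
    note ind = increment_indep_var[OF st(1) this Y(1)]
    have ind2: "indep_var borel Y borel (\<lambda>\<omega>. (?D \<omega>)\<^sup>2)"
      using indep_var_compose[OF ind, of "\<lambda>x. x" borel "\<lambda>x. x\<^sup>2" borel] by (simp add: comp_def)
    show ?thesis
      using indep_var_integrable[OF ind Y(2) int]
        indep_var_lebesgue_integral[OF ind Y(2) int, unfolded increment_mean[OF st]]
        indep_var_integrable[OF ind2 Y(2) square_integrableD[OF sq]]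
        indep_var_lebesgue_integral[OF ind2 Y(2) square_integrableD[OF sq], unfolded increment_variance[OF st]]
      by (simp only: mult_zero_right simp_thms)
  qed
  then show "integrable M (\<lambda>\<omega>. Y \<omega> * ?D \<omega>)" "(\<integral>\<omega>. Y \<omega> * ?D \<omega> \<partial>M) = 0"
    "integrable M (\<lambda>\<omega>. Y \<omega> * (?D \<omega>)\<^sup>2)" "(\<integral>\<omega>. Y \<omega> * (?D \<omega>)\<^sup>2 \<partial>M) = (\<integral>\<omega>. Y \<omega> \<partial>M) * (t - s)"
    by auto
qed

lemma weighted_increment_square_integrable:
  assumes "0 \<le> a" "a \<le> b" "\<xi> \<in> borel_measurable M" "\<And>\<omega>. \<omega> \<in> space M \<Longrightarrow> \<bar>\<xi> \<omega>\<bar> \<le> B"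
  shows "square_integrable M (\<lambda>\<omega>. \<xi> \<omega> * (W b \<omega> - W a \<omega>))"
  using assms by (intro square_integrable_bounded_mult increment_square_integrable)

text \<open>
  Split the longer increment at the end of the shorter one: what comes after that end is
  independent of the past and centred, so only the squared common increment contributes.
\<close>

lemma increment_covariance_same_start:
  assumes abd: "0 \<le> a" "a \<le> b" "b \<le> d"
    and \<eta>: "\<eta> \<in> borel_measurable (F (ennreal a))" "\<And>\<omega>. \<omega> \<in> space M \<Longrightarrow> \<bar>\<eta> \<omega>\<bar> \<le> B"
  shows "(\<integral>\<omega>. \<eta> \<omega> * ((W b \<omega> - W a \<omega>) * (W d \<omega> - W a \<omega>)) \<partial>M) = (\<integral>\<omega>. \<eta> \<omega> \<partial>M) * (b - a)"
proof -
  have \<eta>M: "\<eta> \<in> borel_measurable M" using \<eta>(1) by (rule F_measurable_imp_measurable)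
  have \<eta>int: "integrable M \<eta>"
    using \<eta>(2) \<eta>M by (intro integrable_const_bound[of _ B]) auto
  let ?Y = "\<lambda>\<omega>. \<eta> \<omega> * (W b \<omega> - W a \<omega>)"
  have Y: "?Y \<in> borel_measurable (F (ennreal b))"
    using F_measurable_mono[OF \<eta>(1) abd(2)] F_measurable_mono[OF brownian_measurable_F[OF abd(1)] abd(2)]
      brownian_measurable_F[of b] abd by simp
  have Yint: "integrable M ?Y"
    using weighted_increment_square_integrable[OF abd(1,2) \<eta>M \<eta>(2)]
    by (rule square_integrable_integrable)
  have b0: "0 \<le> b" using abd by simp
  have "(\<integral>\<omega>. \<eta> \<omega> * ((W b \<omega> - W a \<omega>) * (W d \<omega> - W a \<omega>)) \<partial>M)
      = (\<integral>\<omega>. \<eta> \<omega> * (W b \<omega> - W a \<omega>)\<^sup>2 + ?Y \<omega> * (W d \<omega> - W b \<omega>) \<partial>M)"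
    by (intro Bochner_Integration.integral_cong refl) (simp add: power2_eq_square algebra_simps)
  also have "\<dots> = (\<integral>\<omega>. \<eta> \<omega> * (W b \<omega> - W a \<omega>)\<^sup>2 \<partial>M) + (\<integral>\<omega>. ?Y \<omega> * (W d \<omega> - W b \<omega>) \<partial>M)"
    by (intro Bochner_Integration.integral_add increment_square_mult_integrable
        increment_mult_integrable abd \<eta> \<eta>int Y Yint b0)
  also have "\<dots> = (\<integral>\<omega>. \<eta> \<omega> \<partial>M) * (b - a)"
    by (simp only: increment_orthogonal[OF b0 abd(3) Y Yint] increment_square_mult[OF abd(1,2) \<eta>(1) \<eta>int] add_0_right)
  finally show ?thesis .
qed

text \<open>
  Only the overlap of the two intervals matters. The earlier interval is cut at the start \<open>c\<close> of the
  later one; from there on both increments start at \<open>c\<close>, with the product of the two weights as a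
  common weight known at time \<open>c\<close>.
\<close>

lemma weighted_increment_covariance_ordered:
  assumes ab: "0 \<le> a" "a \<le> b" and cd: "c \<le> d" and ac: "a \<le> c"
    and \<xi>: "\<xi> \<in> borel_measurable (F (ennreal a))" "\<And>\<omega>. \<omega> \<in> space M \<Longrightarrow> \<bar>\<xi> \<omega>\<bar> \<le> B"
    and \<zeta>: "\<zeta> \<in> borel_measurable (F (ennreal c))" "\<And>\<omega>. \<omega> \<in> space M \<Longrightarrow> \<bar>\<zeta> \<omega>\<bar> \<le> C"
  shows "(\<integral>\<omega>. (\<xi> \<omega> * (W b \<omega> - W a \<omega>)) * (\<zeta> \<omega> * (W d \<omega> - W c \<omega>)) \<partial>M)
       = (\<integral>\<omega>. \<xi> \<omega> * \<zeta> \<omega> \<partial>M) * max 0 (min b d - c)"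
proof -
  have c0: "0 \<le> c" using ab ac by simp
  have meas: "\<xi> \<in> borel_measurable M" "\<zeta> \<in> borel_measurable M"
    using \<xi>(1) \<zeta>(1) by (auto intro: F_measurable_imp_measurable)
  have \<eta>F: "(\<lambda>\<omega>. \<xi> \<omega> * \<zeta> \<omega>) \<in> borel_measurable (F (ennreal c))"
    using F_measurable_mono[OF \<xi>(1) ac] \<zeta>(1) by simp
  have \<eta>B: "\<bar>\<xi> \<omega> * \<zeta> \<omega>\<bar> \<le> B * C" if "\<omega> \<in> space M" for \<omega>
    unfolding abs_mult using \<xi>(2)[OF that] \<zeta>(2)[OF that] by (intro mult_mono) auto
  \<comment> \<open>the part of an earlier increment that ends before \<open>c\<close> is orthogonal to the later one\<close>
  have early: "(\<integral>\<omega>. (\<xi> \<omega> * (W u \<omega> - W a \<omega>)) * (\<zeta> \<omega> * (W d \<omega> - W c \<omega>)) \<partial>M) = 0"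
    if u: "a \<le> u" "u \<le> c" for u
  proof -
    have int: "integrable M (\<lambda>\<omega>. (\<xi> \<omega> * (W u \<omega> - W a \<omega>)) * \<zeta> \<omega>)"
      using square_integrable_integrable[OF square_integrable_bounded_mult[OF
        weighted_increment_square_integrable[OF ab(1) u(1) meas(1) \<xi>(2)] meas(2) \<zeta>(2)]]
      by (simp add: mult.commute)
    have m: "(\<lambda>\<omega>. (\<xi> \<omega> * (W u \<omega> - W a \<omega>)) * \<zeta> \<omega>) \<in> borel_measurable (F (ennreal c))"
      using F_measurable_mono[OF \<xi>(1) ac] \<zeta>(1) F_measurable_mono[OF brownian_measurable_F[of u] u(2)]
        F_measurable_mono[OF brownian_measurable_F[of a] ac] ab u by simp
    show ?thesis
      using increment_orthogonal[OF c0 cd m int] by (simp add: mult.assoc)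
  qed
  show ?thesis
  proof (cases "b \<le> c")
    case True
    then show ?thesis using early[OF ab(2)] by simp
  next
    case False
    then have cb: "c \<le> b" by simp
    have "(\<integral>\<omega>. (\<xi> \<omega> * (W b \<omega> - W a \<omega>)) * (\<zeta> \<omega> * (W d \<omega> - W c \<omega>)) \<partial>M)
        = (\<integral>\<omega>. (\<xi> \<omega> * (W c \<omega> - W a \<omega>)) * (\<zeta> \<omega> * (W d \<omega> - W c \<omega>))
             + (\<xi> \<omega> * (W b \<omega> - W c \<omega>)) * (\<zeta> \<omega> * (W d \<omega> - W c \<omega>)) \<partial>M)"
      by (intro Bochner_Integration.integral_cong refl) (simp add: algebra_simps)
    also have "\<dots> = (\<integral>\<omega>. (\<xi> \<omega> * (W c \<omega> - W a \<omega>)) * (\<zeta> \<omega> * (W d \<omega> - W c \<omega>)) \<partial>M)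
             + (\<integral>\<omega>. (\<xi> \<omega> * (W b \<omega> - W c \<omega>)) * (\<zeta> \<omega> * (W d \<omega> - W c \<omega>)) \<partial>M)"
      using weighted_increment_square_integrable[OF ab(1) ac meas(1) \<xi>(2)]
        weighted_increment_square_integrable[OF c0 cb meas(1) \<xi>(2)]
        weighted_increment_square_integrable[OF c0 cd meas(2) \<zeta>(2)]
      by (intro Bochner_Integration.integral_add square_integrable_mult_integrable)
    also have "\<dots> = (\<integral>\<omega>. (\<xi> \<omega> * (W b \<omega> - W c \<omega>)) * (\<zeta> \<omega> * (W d \<omega> - W c \<omega>)) \<partial>M)"
      using early[OF ac order_refl] by simp
    also have "\<dots> = (\<integral>\<omega>. \<xi> \<omega> * \<zeta> \<omega> \<partial>M) * (min b d - c)"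
    proof (cases "b \<le> d")
      case True
      then show ?thesis
        using increment_covariance_same_start[OF c0 cb True \<eta>F \<eta>B] by (simp add: mult_ac)
    next
      case False
      then have "d \<le> b" by simp
      then show ?thesis
        using increment_covariance_same_start[OF c0 cd \<open>d \<le> b\<close> \<eta>F \<eta>B] by (simp add: mult_ac)
    qed
    finally show ?thesis using cb cd by simp
  qed
qed

lemma weighted_increment_covariance:
  assumes ab: "0 \<le> a" "a \<le> b" and cd: "0 \<le> c" "c \<le> d"
    and \<xi>: "\<xi> \<in> borel_measurable (F (ennreal a))" "\<And>\<omega>. \<omega> \<in> space M \<Longrightarrow> \<bar>\<xi> \<omega>\<bar> \<le> B"
    and \<zeta>: "\<zeta> \<in> borel_measurable (F (ennreal c))" "\<And>\<omega>. \<omega> \<in> space M \<Longrightarrow> \<bar>\<zeta> \<omega>\<bar> \<le> C"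
  shows "(\<integral>\<omega>. (\<xi> \<omega> * (W b \<omega> - W a \<omega>)) * (\<zeta> \<omega> * (W d \<omega> - W c \<omega>)) \<partial>M)
       = (\<integral>\<omega>. \<xi> \<omega> * \<zeta> \<omega> \<partial>M) * max 0 (min b d - max a c)"
proof (cases "a \<le> c")
  case True
  then show ?thesis
    using weighted_increment_covariance_ordered[OF ab cd(2) True \<xi> \<zeta>] by simp
next
  case False
  then show ?thesis
    using weighted_increment_covariance_ordered[OF cd ab(2) _ \<zeta> \<xi>]
    by (simp add: mult.commute min.commute)
qed

text \<open>
  The weights are known at \<open>a\<close> and \<open>c\<close>, but not at \<open>min a T\<close> and \<open>min c T\<close>. This is harmless: an
  interval that starts after \<open>T\<close> contributes a vanishing increment.
\<close>

lemma stopped_increment_covariance: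
  assumes T: "0 \<le> T" and ab: "0 \<le> a" "a \<le> b" and cd: "0 \<le> c" "c \<le> d"
    and \<xi>: "\<xi> \<in> borel_measurable (F (ennreal a))" "\<And>\<omega>. \<omega> \<in> space M \<Longrightarrow> \<bar>\<xi> \<omega>\<bar> \<le> B"
    and \<zeta>: "\<zeta> \<in> borel_measurable (F (ennreal c))" "\<And>\<omega>. \<omega> \<in> space M \<Longrightarrow> \<bar>\<zeta> \<omega>\<bar> \<le> C"
  shows "(\<integral>\<omega>. (\<xi> \<omega> * (W (min b T) \<omega> - W (min a T) \<omega>)) * (\<zeta> \<omega> * (W (min d T) \<omega> - W (min c T) \<omega>)) \<partial>M)
       = (\<integral>\<omega>. \<xi> \<omega> * \<zeta> \<omega> \<partial>M) * max 0 (min (min b d) T - max a c)"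
proof (cases "a < T \<and> c < T")
  case True
  then have start: "min a T = a" "min c T = c" and le: "a \<le> min b T" "c \<le> min d T"
    using ab cd by auto
  have "min (min b T) (min d T) = min (min b d) T" by (simp add: min_def)
  with weighted_increment_covariance[OF ab(1) le(1) cd(1) le(2) \<xi> \<zeta>] show ?thesis
    unfolding start by (simp only:)
next
  case False
  then have "min a T = min b T \<or> min c T = min d T" using ab cd by auto
  moreover have "max 0 (min (min b d) T - max a c) = 0" using False by auto
  ultimately show ?thesis by auto
qed

end

section \<open>The isometry and martingale property of the Ito integral\<close>

text \<open>
  Integrands are viewed as functions on the product of time and sample space, set to \<open>0\<close> outside
  \<open>[0, T]\<close>, so that the iterated integral in the definition of the Ito integral becomes a squared
  \<open>L\<^sup>2\<close> distance.
\<close>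

definition time_restricted :: "real \<Rightarrow> (real \<Rightarrow> 'a \<Rightarrow> real) \<Rightarrow> real \<times> 'a \<Rightarrow> real" where
  "time_restricted T H = (\<lambda>(t, \<omega>). indicator {0..T} t * H t \<omega>)"

lemma elementary_partition:
  assumes "elementary M F n p \<xi>" "i < n"
  shows "0 \<le> p i" "p i \<le> p (Suc i)"
proof -
  have p: "0 \<le> p 0" "\<forall>i<n. p i \<le> p (Suc i)" using assms(1) by (auto simp: elementary_def)
  have "i \<le> n \<Longrightarrow> 0 \<le> p i" for i
  proof (induction i)
    case (Suc i)
    then show ?case using p(2)[rule_format, of i] by simp
  qed (use p in simp)
  then show "0 \<le> p i" "p i \<le> p (Suc i)" using assms p by auto
qed

lemma elementary_weight:
  assumes "elementary M F n p \<xi>" "i < n"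
  obtains B where "\<xi> i \<in> borel_measurable (F (ennreal (p i)))" "\<And>\<omega>. \<omega> \<in> space M \<Longrightarrow> \<bar>\<xi> i \<omega>\<bar> \<le> B"
  using assms unfolding elementary_def by blast

lemma time_restricted_elementary:
  "time_restricted T (elementary_process n p \<xi>)
    = (\<lambda>x. \<Sum>i<n. time_restricted T (\<lambda>t \<omega>. \<xi> i \<omega> * indicator {p i<..p (Suc i)} t) x)"
  by (rule ext) (simp only: time_restricted_def elementary_process_def sum_distrib_left split_beta)

context brownian_filtration
begin

lemma step_square_integrable:
  assumes \<xi>: "\<xi> \<in> borel_measurable M" "\<And>\<omega>. \<omega> \<in> space M \<Longrightarrow> \<bar>\<xi> \<omega>\<bar> \<le> B"
  shows "square_integrable (lborel \<Otimes>\<^sub>M M) (time_restricted T (\<lambda>t \<omega>. \<xi> \<omega> * indicator {a<..b} t))"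
proof -
  have [measurable]: "\<xi> \<in> borel_measurable M" by (rule \<xi>)
  have sq: "(\<lambda>x. (time_restricted T (\<lambda>t \<omega>. \<xi> \<omega> * indicator {a<..b} t) x)\<^sup>2)
      = (\<lambda>(t, \<omega>). indicator ({0..T} \<inter> {a<..b}) t * (\<xi> \<omega>)\<^sup>2)"
    by (auto simp: time_restricted_def fun_eq_iff split: split_indicator)
  have "square_integrable M (\<lambda>\<omega>. \<xi> \<omega> * 1)"
    by (rule square_integrable_bounded_mult[OF _ \<xi>]) (auto simp: square_integrable_def)
  then have "integrable M (\<lambda>\<omega>. (\<xi> \<omega>)\<^sup>2)" by (simp add: square_integrable_def)
  moreover have "integrable lborel (indicator ({0..T} \<inter> {a<..b}) :: real \<Rightarrow> real)"
  proof -
    have "emeasure lborel ({0..T} \<inter> {a<..b}) \<le> emeasure lborel {0..T}" by (intro emeasure_mono) auto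
    also have "\<dots> < \<infinity>" by (rule emeasure_lborel_cbox_finite[of 0 T, unfolded cbox_interval])
    finally show ?thesis by (intro integrable_real_indicator) auto
  qed
  ultimately show ?thesis
    unfolding square_integrable_def sq
    by (intro conjI time.integrable_pair_mult) (simp_all add: time_restricted_def)
qed

text \<open>
  The right-hand side is the one of \<open>stopped_increment_covariance\<close>; their equality is the isometry for
  a single pair of steps.
\<close>

lemma step_covariance:
  assumes "0 \<le> a"
    and \<xi>: "\<xi> \<in> borel_measurable M" "\<And>\<omega>. \<omega> \<in> space M \<Longrightarrow> \<bar>\<xi> \<omega>\<bar> \<le> B"
    and \<zeta>: "\<zeta> \<in> borel_measurable M" "\<And>\<omega>. \<omega> \<in> space M \<Longrightarrow> \<bar>\<zeta> \<omega>\<bar> \<le> C"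
  shows "(\<integral>x. time_restricted T (\<lambda>t \<omega>. \<xi> \<omega> * indicator {a<..b} t) x
             * time_restricted T (\<lambda>t \<omega>. \<zeta> \<omega> * indicator {c<..d} t) x \<partial>(lborel \<Otimes>\<^sub>M M))
       = (\<integral>\<omega>. \<xi> \<omega> * \<zeta> \<omega> \<partial>M) * max 0 (min (min b d) T - max a c)"
proof -
  let ?A = "{max a c<..min (min b d) T}"
  have prod: "(\<lambda>x. time_restricted T (\<lambda>t \<omega>. \<xi> \<omega> * indicator {a<..b} t) x
             * time_restricted T (\<lambda>t \<omega>. \<zeta> \<omega> * indicator {c<..d} t) x)
      = (\<lambda>(t, \<omega>). indicator ?A t * (\<xi> \<omega> * \<zeta> \<omega>))"
    using assms(1) by (auto simp: time_restricted_def fun_eq_iff split: split_indicator)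
  have "square_integrable M (\<lambda>\<omega>. \<xi> \<omega> * 1)" "square_integrable M (\<lambda>\<omega>. \<zeta> \<omega> * 1)"
    by (rule square_integrable_bounded_mult[OF _ \<xi>] square_integrable_bounded_mult[OF _ \<zeta>];
        simp add: square_integrable_def)+
  then have int: "integrable M (\<lambda>\<omega>. \<xi> \<omega> * \<zeta> \<omega>)"
    using square_integrable_mult_integrable by fastforce
  have len: "emeasure lborel ?A = ennreal (max 0 (min (min b d) T - max a c))"
    by (cases "max a c \<le> min (min b d) T") (auto simp: max_def not_le)
  have "integrable lborel (indicator ?A :: real \<Rightarrow> real)"
    by (intro integrable_real_indicator) (auto simp: len)
  moreover have "(\<integral>t. indicator ?A t \<partial>lborel) = max 0 (min (min b d) T - max a c)"
  proof -
    have "measure lborel ?A = max 0 (min (min b d) T - max a c)"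
      unfolding measure_def len by (rule enn2real_ennreal) simp
    then show ?thesis by simp
  qed
  ultimately show ?thesis
    unfolding prod using time.integral_pair_mult[OF _ int, of "indicator ?A"] by (simp add: mult.commute)
qed

lemma elementary_integral_summand_square_integrable:
  assumes e: "elementary M F n p \<xi>" "i < n" and T: "0 \<le> T"
  shows "square_integrable M (\<lambda>\<omega>. \<xi> i \<omega> * (W (min (p (Suc i)) T) \<omega> - W (min (p i) T) \<omega>))"
proof -
  obtain B where "\<xi> i \<in> borel_measurable (F (ennreal (p i)))" "\<And>\<omega>. \<omega> \<in> space M \<Longrightarrow> \<bar>\<xi> i \<omega>\<bar> \<le> B"
    using elementary_weight[OF e] by blast
  moreover have "0 \<le> min (p i) T" "min (p i) T \<le> min (p (Suc i)) T"
    using elementary_partition[OF e] T by auto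
  ultimately show ?thesis
    by (metis weighted_increment_square_integrable F_measurable_imp_measurable)
qed

lemma elementary_integral_square_integrable:
  assumes "elementary M F n p \<xi>" "0 \<le> T"
  shows "square_integrable M (elementary_integral W n p \<xi> T)"
proof -
  have "square_integrable M (\<lambda>\<omega>. \<Sum>i<n. \<xi> i \<omega> * (W (min (p (Suc i)) T) \<omega> - W (min (p i) T) \<omega>))"
    using assms by (intro square_integrable_sum elementary_integral_summand_square_integrable) auto
  then show ?thesis by (simp add: elementary_integral_def[abs_def])
qed

lemma elementary_process_summand_square_integrable:
  assumes e: "elementary M F n p \<xi>" "i < n"
  shows "square_integrable (lborel \<Otimes>\<^sub>M M) (time_restricted T (\<lambda>t \<omega>. \<xi> i \<omega> * indicator {p i<..p (Suc i)} t))"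
proof -
  obtain B where "\<xi> i \<in> borel_measurable (F (ennreal (p i)))" "\<And>\<omega>. \<omega> \<in> space M \<Longrightarrow> \<bar>\<xi> i \<omega>\<bar> \<le> B"
    using elementary_weight[OF e] by blast
  then show ?thesis by (metis step_square_integrable F_measurable_imp_measurable)
qed

lemma elementary_process_square_integrable:
  assumes "elementary M F n p \<xi>"
  shows "square_integrable (lborel \<Otimes>\<^sub>M M) (time_restricted T (elementary_process n p \<xi>))"
  unfolding time_restricted_elementary
  using assms by (intro square_integrable_sum elementary_process_summand_square_integrable) auto

text \<open>
  Both sides are bilinear in the steps, so the claim reduces to pairs of steps; in particular the two
  partitions can be unrelated.
\<close>

lemma elementary_integral_inner:
  assumes e: "elementary M F n p \<xi>" and f: "elementary M F m q \<zeta>" and T: "0 \<le> T"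
  shows "(\<integral>\<omega>. elementary_integral W n p \<xi> T \<omega> * elementary_integral W m q \<zeta> T \<omega> \<partial>M)
       = (\<integral>x. time_restricted T (elementary_process n p \<xi>) x
            * time_restricted T (elementary_process m q \<zeta>) x \<partial>(lborel \<Otimes>\<^sub>M M))"
proof -
  have "(\<integral>\<omega>. elementary_integral W n p \<xi> T \<omega> * elementary_integral W m q \<zeta> T \<omega> \<partial>M)
      = (\<Sum>i<n. \<Sum>j<m. \<integral>\<omega>. (\<xi> i \<omega> * (W (min (p (Suc i)) T) \<omega> - W (min (p i) T) \<omega>))
            * (\<zeta> j \<omega> * (W (min (q (Suc j)) T) \<omega> - W (min (q j) T) \<omega>)) \<partial>M)"
    unfolding elementary_integral_def
    by (intro integral_sum_mult_sum) (auto intro: elementary_integral_summand_square_integrable e f T)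
  also have "\<dots> = (\<Sum>i<n. \<Sum>j<m. \<integral>x. time_restricted T (\<lambda>t \<omega>. \<xi> i \<omega> * indicator {p i<..p (Suc i)} t) x
            * time_restricted T (\<lambda>t \<omega>. \<zeta> j \<omega> * indicator {q j<..q (Suc j)} t) x \<partial>(lborel \<Otimes>\<^sub>M M))"
  proof (intro sum.cong refl)
    fix i j assume "i \<in> {..<n}" "j \<in> {..<m}"
    then have ij: "i < n" "j < m" by auto
    obtain B where B: "\<xi> i \<in> borel_measurable (F (ennreal (p i)))" "\<And>\<omega>. \<omega> \<in> space M \<Longrightarrow> \<bar>\<xi> i \<omega>\<bar> \<le> B"
      using elementary_weight[OF e ij(1)] by blast
    obtain C where C: "\<zeta> j \<in> borel_measurable (F (ennreal (q j)))" "\<And>\<omega>. \<omega> \<in> space M \<Longrightarrow> \<bar>\<zeta> j \<omega>\<bar> \<le> C"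
      using elementary_weight[OF f ij(2)] by blast
    note BM = F_measurable_imp_measurable[OF B(1)] and CM = F_measurable_imp_measurable[OF C(1)]
    show "(\<integral>\<omega>. (\<xi> i \<omega> * (W (min (p (Suc i)) T) \<omega> - W (min (p i) T) \<omega>))
            * (\<zeta> j \<omega> * (W (min (q (Suc j)) T) \<omega> - W (min (q j) T) \<omega>)) \<partial>M)
        = (\<integral>x. time_restricted T (\<lambda>t \<omega>. \<xi> i \<omega> * indicator {p i<..p (Suc i)} t) x
            * time_restricted T (\<lambda>t \<omega>. \<zeta> j \<omega> * indicator {q j<..q (Suc j)} t) x \<partial>(lborel \<Otimes>\<^sub>M M))"
      by (rule trans[OF stopped_increment_covariance[OF T elementary_partition[OF e ij(1)] elementary_partition[OF f ij(2)] B C]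
          step_covariance[OF elementary_partition(1)[OF e ij(1)] BM B(2) CM C(2), symmetric]])
  qed
  also have "\<dots> = (\<integral>x. time_restricted T (elementary_process n p \<xi>) x
            * time_restricted T (elementary_process m q \<zeta>) x \<partial>(lborel \<Otimes>\<^sub>M M))"
    unfolding time_restricted_elementary
    by (intro integral_sum_mult_sum[symmetric]) (auto intro: elementary_process_summand_square_integrable e f)
  finally show ?thesis .
qed

lemma elementary_integral_isometry:
  assumes e: "elementary M F n p \<xi>" and f: "elementary M F m q \<zeta>" and T: "0 \<le> T"
  shows "(\<integral>\<omega>. (elementary_integral W n p \<xi> T \<omega> - elementary_integral W m q \<zeta> T \<omega>)\<^sup>2 \<partial>M)
       = (\<integral>x. (time_restricted T (elementary_process n p \<xi>) x
            - time_restricted T (elementary_process m q \<zeta>) x)\<^sup>2 \<partial>(lborel \<Otimes>\<^sub>M M))"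
  unfolding integral_square_diff[OF elementary_integral_square_integrable[OF e T] elementary_integral_square_integrable[OF f T]]
    integral_square_diff[OF elementary_process_square_integrable[OF e] elementary_process_square_integrable[OF f]]
  using elementary_integral_inner[OF e e T] elementary_integral_inner[OF f f T] elementary_integral_inner[OF e f T]
  by (simp add: power2_eq_square)

text \<open>
  Between \<open>S\<close> and \<open>T\<close> each summand changes by its weight times an increment that starts at or after
  \<open>S\<close>. If the weight is known when that increment starts, the product of \<open>Z\<close> and the weight is
  orthogonal to it; otherwise the increment vanishes.
\<close>

lemma elementary_integral_martingale:
  assumes e: "elementary M F n p \<xi>" and ST: "0 \<le> S" "S \<le> T"
    and Z: "Z \<in> borel_measurable (F (ennreal S))" "square_integrable M Z"
  shows "(\<integral>\<omega>. Z \<omega> * elementary_integral W n p \<xi> T \<omega> \<partial>M) = (\<integral>\<omega>. Z \<omega> * elementary_integral W n p \<xi> S \<omega> \<partial>M)"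
proof -
  have T: "0 \<le> T" using ST by simp
  \<comment> \<open>the part of the interval \<open>(p i, p (i + 1)]\<close> that lies between \<open>S\<close> and \<open>T\<close>, collapsed to a point
      if there is none\<close>
  define u v where "u i = max (min (p i) T) S" and "v i = max (min (p (Suc i)) T) S" for i
  have zero: "integrable M (\<lambda>\<omega>. Z \<omega> * \<xi> i \<omega> * (W (v i) \<omega> - W (u i) \<omega>)) \<and>
      (\<integral>\<omega>. Z \<omega> * \<xi> i \<omega> * (W (v i) \<omega> - W (u i) \<omega>) \<partial>M) = 0" if i: "i < n" for i
  proof -
    obtain B where B: "\<xi> i \<in> borel_measurable (F (ennreal (p i)))" "\<And>\<omega>. \<omega> \<in> space M \<Longrightarrow> \<bar>\<xi> i \<omega>\<bar> \<le> B"
      using elementary_weight[OF e i] by blast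
    note p = elementary_partition[OF e i]
    show ?thesis
    proof (cases "p i \<le> T")
      case False
      then have "u i = v i" using p by (simp add: u_def v_def)
      then show ?thesis by simp
    next
      case True
      then have pu: "p i \<le> u i" by (simp add: u_def)
      have Su: "S \<le> u i" by (simp add: u_def)
      have uv: "0 \<le> u i" "u i \<le> v i" using p ST by (auto simp: u_def v_def)
      have "(\<lambda>\<omega>. Z \<omega> * \<xi> i \<omega>) \<in> borel_measurable (F (ennreal (u i)))"
        using F_measurable_mono[OF Z(1) Su] F_measurable_mono[OF B(1) pu] by simp
      moreover have "integrable M (\<lambda>\<omega>. Z \<omega> * \<xi> i \<omega>)"
        using square_integrable_integrable[OF square_integrable_bounded_mult[OF Z(2) F_measurable_imp_measurable[OF B(1)] B(2)]]
        by (simp add: mult.commute)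
      ultimately show ?thesis
        using increment_mult_integrable[OF uv] increment_orthogonal[OF uv] by blast
    qed
  qed
  have incr: "W (min (p (Suc i)) T) \<omega> - W (min (p i) T) \<omega> - (W (min (p (Suc i)) S) \<omega> - W (min (p i) S) \<omega>)
      = W (v i) \<omega> - W (u i) \<omega>" if "i < n" for i \<omega>
  proof -
    note p = elementary_partition[OF e that]
    consider "S \<le> p i" | "p i < S" "S \<le> p (Suc i)" | "p (Suc i) < S" by linarith
    then show ?thesis
    proof cases
      case 1
      then have "u i = min (p i) T" "v i = min (p (Suc i)) T" "min (p i) S = S" "min (p (Suc i)) S = S"
        using p ST by (auto simp: u_def v_def)
      then show ?thesis by simp
    next
      case 2
      then have "u i = S" "v i = min (p (Suc i)) T" "min (p i) S = p i" "min (p i) T = p i" "min (p (Suc i)) S = S"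
        using p ST by (auto simp: u_def v_def)
      then show ?thesis by simp
    next
      case 3
      then have "u i = S" "v i = S" "min (p i) S = p i" "min (p i) T = p i"
        "min (p (Suc i)) S = p (Suc i)" "min (p (Suc i)) T = p (Suc i)"
        using p ST by (auto simp: u_def v_def)
      then show ?thesis by simp
    qed
  qed
  have "(\<integral>\<omega>. Z \<omega> * elementary_integral W n p \<xi> T \<omega> \<partial>M) - (\<integral>\<omega>. Z \<omega> * elementary_integral W n p \<xi> S \<omega> \<partial>M)
      = (\<integral>\<omega>. Z \<omega> * elementary_integral W n p \<xi> T \<omega> - Z \<omega> * elementary_integral W n p \<xi> S \<omega> \<partial>M)"
    by (intro Bochner_Integration.integral_diff[symmetric] square_integrable_mult_integrable Z(2)
        elementary_integral_square_integrable[OF e] T ST)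
  also have "\<dots> = (\<integral>\<omega>. (\<Sum>i<n. Z \<omega> * \<xi> i \<omega> * (W (v i) \<omega> - W (u i) \<omega>)) \<partial>M)"
  proof (intro Bochner_Integration.integral_cong refl)
    fix \<omega>
    show "Z \<omega> * elementary_integral W n p \<xi> T \<omega> - Z \<omega> * elementary_integral W n p \<xi> S \<omega>
        = (\<Sum>i<n. Z \<omega> * \<xi> i \<omega> * (W (v i) \<omega> - W (u i) \<omega>))"
      unfolding elementary_integral_def sum_distrib_left sum_subtractf[symmetric]
    proof (intro sum.cong refl)
      fix i assume "i \<in> {..<n}"
      then show "Z \<omega> * (\<xi> i \<omega> * (W (min (p (Suc i)) T) \<omega> - W (min (p i) T) \<omega>)) -
         Z \<omega> * (\<xi> i \<omega> * (W (min (p (Suc i)) S) \<omega> - W (min (p i) S) \<omega>)) =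
         Z \<omega> * \<xi> i \<omega> * (W (v i) \<omega> - W (u i) \<omega>)"
        using incr[of i \<omega>] by (simp only: right_diff_distrib[symmetric] mult.assoc lessThan_iff)
    qed
  qed
  also have "\<dots> = (\<Sum>i<n. \<integral>\<omega>. Z \<omega> * \<xi> i \<omega> * (W (v i) \<omega> - W (u i) \<omega>) \<partial>M)"
    using zero by (intro Bochner_Integration.integral_sum) auto
  also have "\<dots> = 0" using zero by (intro sum.neutral) auto
  finally show ?thesis by simp
qed

lemma elementary_integral_mean:
  assumes e: "elementary M F n p \<xi>" and T: "0 \<le> T"
  shows "(\<integral>\<omega>. elementary_integral W n p \<xi> T \<omega> \<partial>M) = 0"
proof -
  have "elementary_integral W n p \<xi> 0 = (\<lambda>\<omega>. 0)"
    unfolding elementary_integral_def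
  proof (intro ext sum.neutral ballI)
    fix i \<omega> assume "i \<in> {..<n}"
    then have "0 \<le> p i" "p i \<le> p (Suc i)" using elementary_partition[OF e] by auto
    then show "\<xi> i \<omega> * (W (min (p (Suc i)) 0) \<omega> - W (min (p i) 0) \<omega>) = 0" by (simp add: min_absorb2)
  qed
  moreover have "square_integrable M (\<lambda>_. 1 :: real)" by (simp add: square_integrable_def)
  ultimately show ?thesis
    using elementary_integral_martingale[OF e order_refl T, of "\<lambda>_. 1"] by simp
qed

lemma time_restricted_measurable:
  assumes "(\<lambda>(t, \<omega>). H t \<omega>) \<in> borel_measurable (restrict_space borel {0..T} \<Otimes>\<^sub>M M)" and T: "0 \<le> T"
  shows "time_restricted T H \<in> borel_measurable (lborel \<Otimes>\<^sub>M M)"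
proof -
  \<comment> \<open>measurability is only assumed for times in \<open>[0, T]\<close>; clamping time to this interval extends it\<close>
  have clamp: "(\<lambda>t. max 0 (min T t)) \<in> lborel \<rightarrow>\<^sub>M restrict_space borel {0..T}"
    using T by (intro measurable_restrict_space2) auto
  have "(\<lambda>(t, \<omega>). (max 0 (min T t), \<omega>)) \<in> lborel \<Otimes>\<^sub>M M \<rightarrow>\<^sub>M restrict_space borel {0..T} \<Otimes>\<^sub>M M"
    using measurable_Pair[OF measurable_compose[OF measurable_fst clamp] measurable_snd] by (simp add: split_beta')
  from measurable_compose[OF this assms(1)]
  have [measurable]: "(\<lambda>(t, \<omega>). H (max 0 (min T t)) \<omega>) \<in> borel_measurable (lborel \<Otimes>\<^sub>M M)"
    by (simp add: split_beta')
  have "time_restricted T H = (\<lambda>x. indicator {0..T} (fst x) * (case x of (t, \<omega>) \<Rightarrow> H (max 0 (min T t)) \<omega>))"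
    by (auto simp: time_restricted_def fun_eq_iff split: split_indicator)
  then show ?thesis by simp
qed

lemma nn_integral_time_restricted:
  assumes "time_restricted T H \<in> borel_measurable (lborel \<Otimes>\<^sub>M M)"
  shows "(\<integral>\<^sup>+\<omega>. (\<integral>\<^sup>+t\<in>{0..T}. ennreal ((H t \<omega>)\<^sup>2) \<partial>lborel) \<partial>M)
       = (\<integral>\<^sup>+x. ennreal ((time_restricted T H x)\<^sup>2) \<partial>(lborel \<Otimes>\<^sub>M M))"
proof -
  have "(\<integral>\<^sup>+\<omega>. (\<integral>\<^sup>+t\<in>{0..T}. ennreal ((H t \<omega>)\<^sup>2) \<partial>lborel) \<partial>M)
      = (\<integral>\<^sup>+\<omega>. (\<integral>\<^sup>+t. ennreal ((time_restricted T H (t, \<omega>))\<^sup>2) \<partial>lborel) \<partial>M)"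
    by (intro nn_integral_cong) (auto simp: time_restricted_def split: split_indicator)
  also have "\<dots> = (\<integral>\<^sup>+x. ennreal ((time_restricted T H x)\<^sup>2) \<partial>(lborel \<Otimes>\<^sub>M M))"
    using assms by (intro time.nn_integral_snd) simp
  finally show ?thesis .
qed

text \<open>
  The definition of the Ito integral in the language of \<open>L\<^sup>2\<close> limits. Square-integrability of the
  integral comes for free from that of the approximating elementary integrals.
\<close>

lemma has_ito_integral_approximation:
  assumes I: "has_ito_integral M F W H T I" and T: "0 \<le> T"
  obtains n p \<xi> where
    "\<And>k::nat. elementary M F (n k) (p k) (\<xi> k)"
    "square_integrable (lborel \<Otimes>\<^sub>M M) (time_restricted T H)"
    "square_integrable M I"
    "(\<lambda>k. \<integral>x. (time_restricted T (elementary_process (n k) (p k) (\<xi> k)) x - time_restricted T H x)\<^sup>2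
        \<partial>(lborel \<Otimes>\<^sub>M M)) \<longlonglongrightarrow> 0"
    "(\<lambda>k. \<integral>\<omega>. (elementary_integral W (n k) (p k) (\<xi> k) T \<omega> - I \<omega>)\<^sup>2 \<partial>M) \<longlonglongrightarrow> 0"
proof -
  from I obtain n p \<xi> where e: "\<And>k::nat. elementary M F (n k) (p k) (\<xi> k)"
    and l1: "(\<lambda>k. \<integral>\<^sup>+\<omega>. (\<integral>\<^sup>+t\<in>{0..T}.
            ennreal ((elementary_process (n k) (p k) (\<xi> k) t \<omega> - H t \<omega>)\<^sup>2) \<partial>lborel) \<partial>M) \<longlonglongrightarrow> 0"
    and l2: "(\<lambda>k. \<integral>\<^sup>+\<omega>. ennreal ((elementary_integral W (n k) (p k) (\<xi> k) T \<omega> - I \<omega>)\<^sup>2) \<partial>M) \<longlonglongrightarrow> 0"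
    and H: "ito_integrand M F H T" and Im: "I \<in> borel_measurable M"
    unfolding has_ito_integral_def by blast
  have Hm: "time_restricted T H \<in> borel_measurable (lborel \<Otimes>\<^sub>M M)"
    using H T by (intro time_restricted_measurable) (auto simp: ito_integrand_def)
  have H2: "square_integrable (lborel \<Otimes>\<^sub>M M) (time_restricted T H)"
    using H Hm nn_integral_time_restricted[OF Hm]
    by (simp add: square_integrable_iff_nn_integral ito_integrand_def)
  note e2 = elementary_process_square_integrable[OF e]
  have d: "time_restricted T (\<lambda>t \<omega>. elementary_process (n k) (p k) (\<xi> k) t \<omega> - H t \<omega>)
      = (\<lambda>x. time_restricted T (elementary_process (n k) (p k) (\<xi> k)) x - time_restricted T H x)" for k
    by (auto simp: time_restricted_def fun_eq_iff algebra_simps)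
  have dm: "time_restricted T (\<lambda>t \<omega>. elementary_process (n k) (p k) (\<xi> k) t \<omega> - H t \<omega>)
      \<in> borel_measurable (lborel \<Otimes>\<^sub>M M)" for k
    unfolding d using Hm square_integrable_measurable[OF e2] by simp
  from l1 have "(\<lambda>k. \<integral>x. (time_restricted T (elementary_process (n k) (p k) (\<xi> k)) x - time_restricted T H x)\<^sup>2
        \<partial>(lborel \<Otimes>\<^sub>M M)) \<longlonglongrightarrow> 0"
    unfolding nn_integral_time_restricted[OF dm] d
    using square_limit_real_iff[OF e2 H2] by simp
  moreover have I2: "square_integrable M I"
    by (rule square_integrable_limit[OF elementary_integral_square_integrable[OF e T] Im l2])
  moreover from l2 have "(\<lambda>k. \<integral>\<omega>. (elementary_integral W (n k) (p k) (\<xi> k) T \<omega> - I \<omega>)\<^sup>2 \<partial>M) \<longlonglongrightarrow> 0"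
    using square_limit_real_iff[OF elementary_integral_square_integrable[OF e T] I2] by simp
  ultimately show ?thesis using e H2 that by blast
qed

lemma ito_integral_square_integrable:
  assumes "has_ito_integral M F W H T I" "0 \<le> T"
  shows "square_integrable M I" "square_integrable (lborel \<Otimes>\<^sub>M M) (time_restricted T H)"
  using has_ito_integral_approximation[OF assms] by blast+

lemma ito_isometry:
  assumes I: "has_ito_integral M F W H T I" and T: "0 \<le> T"
  shows "(\<integral>\<omega>. (I \<omega>)\<^sup>2 \<partial>M) = (\<integral>x. (time_restricted T H x)\<^sup>2 \<partial>(lborel \<Otimes>\<^sub>M M))"
proof -
  obtain n p \<xi> where e: "\<And>k::nat. elementary M F (n k) (p k) (\<xi> k)"
    and H2: "square_integrable (lborel \<Otimes>\<^sub>M M) (time_restricted T H)" and I2: "square_integrable M I"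
    and l1: "(\<lambda>k. \<integral>x. (time_restricted T (elementary_process (n k) (p k) (\<xi> k)) x - time_restricted T H x)\<^sup>2
        \<partial>(lborel \<Otimes>\<^sub>M M)) \<longlonglongrightarrow> 0"
    and l2: "(\<lambda>k. \<integral>\<omega>. (elementary_integral W (n k) (p k) (\<xi> k) T \<omega> - I \<omega>)\<^sup>2 \<partial>M) \<longlonglongrightarrow> 0"
    by (rule has_ito_integral_approximation[OF I T]) blast
  have "(\<integral>\<omega>. (elementary_integral W (n k) (p k) (\<xi> k) T \<omega>)\<^sup>2 \<partial>M)
      = (\<integral>x. (time_restricted T (elementary_process (n k) (p k) (\<xi> k)) x)\<^sup>2 \<partial>(lborel \<Otimes>\<^sub>M M))" for k
    using elementary_integral_inner[OF e e T, of k k] by (simp add: power2_eq_square)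
  with integral_square_limit[OF elementary_integral_square_integrable[OF e T] I2 l2]
  have "(\<lambda>k. \<integral>x. (time_restricted T (elementary_process (n k) (p k) (\<xi> k)) x)\<^sup>2 \<partial>(lborel \<Otimes>\<^sub>M M))
      \<longlonglongrightarrow> (\<integral>\<omega>. (I \<omega>)\<^sup>2 \<partial>M)" by (simp only:)
  then show ?thesis
    using integral_square_limit[OF elementary_process_square_integrable[OF e] H2 l1] by (rule LIMSEQ_unique)
qed

lemma ito_integral_mean:
  assumes I: "has_ito_integral M F W H T I" and T: "0 \<le> T"
  shows "(\<integral>\<omega>. I \<omega> \<partial>M) = 0"
proof -
  obtain n p \<xi> where e: "\<And>k::nat. elementary M F (n k) (p k) (\<xi> k)" and I2: "square_integrable M I"
    and l2: "(\<lambda>k. \<integral>\<omega>. (elementary_integral W (n k) (p k) (\<xi> k) T \<omega> - I \<omega>)\<^sup>2 \<partial>M) \<longlonglongrightarrow> 0"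
    by (rule has_ito_integral_approximation[OF I T]) blast
  have "square_integrable M (\<lambda>_. 1 :: real)" by (simp add: square_integrable_def)
  from integral_mult_limit[OF elementary_integral_square_integrable[OF e T] I2 this l2]
  have "(\<lambda>k. 0 :: real) \<longlonglongrightarrow> (\<integral>\<omega>. I \<omega> \<partial>M)" by (simp add: elementary_integral_mean[OF e T])
  then show ?thesis by (rule LIMSEQ_unique) (rule tendsto_const)
qed

lemma time_restricted_square_mono:
  assumes ST: "S \<le> T"
    and G: "square_integrable (lborel \<Otimes>\<^sub>M M) (time_restricted T G)"
    and H: "square_integrable (lborel \<Otimes>\<^sub>M M) (time_restricted T H)"
  shows "(\<integral>x. (time_restricted S G x - time_restricted S H x)\<^sup>2 \<partial>(lborel \<Otimes>\<^sub>M M))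
       \<le> (\<integral>x. (time_restricted T G x - time_restricted T H x)\<^sup>2 \<partial>(lborel \<Otimes>\<^sub>M M))"
proof (rule integral_mono')
  show "integrable (lborel \<Otimes>\<^sub>M M) (\<lambda>x. (time_restricted T G x - time_restricted T H x)\<^sup>2)"
    using square_integrable_diff[OF G H] by (rule square_integrableD)
qed (use ST in \<open>auto simp: time_restricted_def split: split_indicator\<close>)

text \<open>
  The values \<open>I\<close> at \<open>T\<close> and \<open>J\<close> at \<open>S\<close> belong to possibly different approximating sequences. By the
  isometry on \<open>[0, S]\<close> the sequence for \<open>I\<close>, stopped at \<open>S\<close>, also converges to \<open>J\<close>, so that the
  martingale property of its members passes to the limit.
\<close>

lemma ito_integral_martingale:
  assumes IT: "has_ito_integral M F W H T I" and IS: "has_ito_integral M F W H S J"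
    and ST: "0 \<le> S" "S \<le> T"
    and Z: "Z \<in> borel_measurable (F (ennreal S))" "square_integrable M Z"
  shows "(\<integral>\<omega>. Z \<omega> * I \<omega> \<partial>M) = (\<integral>\<omega>. Z \<omega> * J \<omega> \<partial>M)"
proof -
  have T: "0 \<le> T" using ST by simp
  obtain n p \<xi> where e: "\<And>k::nat. elementary M F (n k) (p k) (\<xi> k)"
    and HT: "square_integrable (lborel \<Otimes>\<^sub>M M) (time_restricted T H)" and I2: "square_integrable M I"
    and l1: "(\<lambda>k. \<integral>x. (time_restricted T (elementary_process (n k) (p k) (\<xi> k)) x - time_restricted T H x)\<^sup>2
        \<partial>(lborel \<Otimes>\<^sub>M M)) \<longlonglongrightarrow> 0"
    and l2: "(\<lambda>k. \<integral>\<omega>. (elementary_integral W (n k) (p k) (\<xi> k) T \<omega> - I \<omega>)\<^sup>2 \<partial>M) \<longlonglongrightarrow> 0"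
    by (rule has_ito_integral_approximation[OF IT T]) blast
  obtain m q \<zeta> where f: "\<And>k::nat. elementary M F (m k) (q k) (\<zeta> k)"
    and HS: "square_integrable (lborel \<Otimes>\<^sub>M M) (time_restricted S H)" and J2: "square_integrable M J"
    and l3: "(\<lambda>k. \<integral>x. (time_restricted S (elementary_process (m k) (q k) (\<zeta> k)) x - time_restricted S H x)\<^sup>2
        \<partial>(lborel \<Otimes>\<^sub>M M)) \<longlonglongrightarrow> 0"
    and l4: "(\<lambda>k. \<integral>\<omega>. (elementary_integral W (m k) (q k) (\<zeta> k) S \<omega> - J \<omega>)\<^sup>2 \<partial>M) \<longlonglongrightarrow> 0"
    by (rule has_ito_integral_approximation[OF IS ST(1)]) blast
  let ?e = "\<lambda>R k. time_restricted R (elementary_process (n k) (p k) (\<xi> k))"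
  let ?f = "\<lambda>R k. time_restricted R (elementary_process (m k) (q k) (\<zeta> k))"
  let ?E = "\<lambda>R k. elementary_integral W (n k) (p k) (\<xi> k) R"
  let ?F = "\<lambda>R k. elementary_integral W (m k) (q k) (\<zeta> k) R"
  note e2 = elementary_process_square_integrable[OF e] and f2 = elementary_process_square_integrable[OF f]
  note E2 = elementary_integral_square_integrable[OF e] and F2 = elementary_integral_square_integrable[OF f]
  \<comment> \<open>the constants 4, 4, 2 come from applying the parallelogram inequality twice\<close>
  have bound: "(\<integral>\<omega>. (?E S k \<omega> - J \<omega>)\<^sup>2 \<partial>M)
      \<le> 4 * (\<integral>x. (?e T k x - time_restricted T H x)\<^sup>2 \<partial>(lborel \<Otimes>\<^sub>M M))
       + 4 * (\<integral>x. (?f S k x - time_restricted S H x)\<^sup>2 \<partial>(lborel \<Otimes>\<^sub>M M))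
       + 2 * (\<integral>\<omega>. (?F S k \<omega> - J \<omega>)\<^sup>2 \<partial>M)" for k
  proof -
    have "(\<integral>\<omega>. (?E S k \<omega> - J \<omega>)\<^sup>2 \<partial>M)
        \<le> 2 * (\<integral>\<omega>. (?E S k \<omega> - ?F S k \<omega>)\<^sup>2 \<partial>M) + 2 * (\<integral>\<omega>. (?F S k \<omega> - J \<omega>)\<^sup>2 \<partial>M)"
      by (rule integral_square_diff_le[OF E2[OF ST(1)] F2[OF ST(1)] J2])
    moreover have "(\<integral>\<omega>. (?E S k \<omega> - ?F S k \<omega>)\<^sup>2 \<partial>M) = (\<integral>x. (?e S k x - ?f S k x)\<^sup>2 \<partial>(lborel \<Otimes>\<^sub>M M))"
      by (rule elementary_integral_isometry[OF e f ST(1)])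
    moreover have "\<dots> \<le> 2 * (\<integral>x. (?e S k x - time_restricted S H x)\<^sup>2 \<partial>(lborel \<Otimes>\<^sub>M M))
        + 2 * (\<integral>x. (time_restricted S H x - ?f S k x)\<^sup>2 \<partial>(lborel \<Otimes>\<^sub>M M))"
      by (rule integral_square_diff_le[OF e2 HS f2])
    moreover have "(\<integral>x. (?e S k x - time_restricted S H x)\<^sup>2 \<partial>(lborel \<Otimes>\<^sub>M M))
        \<le> (\<integral>x. (?e T k x - time_restricted T H x)\<^sup>2 \<partial>(lborel \<Otimes>\<^sub>M M))"
      by (rule time_restricted_square_mono[OF ST(2) e2 HT])
    ultimately show ?thesis by (simp add: power2_commute[of "time_restricted S H _"])
  qed
  have "(\<lambda>k. 4 * (\<integral>x. (?e T k x - time_restricted T H x)\<^sup>2 \<partial>(lborel \<Otimes>\<^sub>M M))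
       + 4 * (\<integral>x. (?f S k x - time_restricted S H x)\<^sup>2 \<partial>(lborel \<Otimes>\<^sub>M M))
       + 2 * (\<integral>\<omega>. (?F S k \<omega> - J \<omega>)\<^sup>2 \<partial>M)) \<longlonglongrightarrow> 4 * 0 + 4 * 0 + 2 * 0"
    by (intro tendsto_intros l1 l3 l4)
  then have lim0: "(\<lambda>k. 4 * (\<integral>x. (?e T k x - time_restricted T H x)\<^sup>2 \<partial>(lborel \<Otimes>\<^sub>M M))
       + 4 * (\<integral>x. (?f S k x - time_restricted S H x)\<^sup>2 \<partial>(lborel \<Otimes>\<^sub>M M))
       + 2 * (\<integral>\<omega>. (?F S k \<omega> - J \<omega>)\<^sup>2 \<partial>M)) \<longlonglongrightarrow> 0" by simp
  have l5: "(\<lambda>k. \<integral>\<omega>. (?E S k \<omega> - J \<omega>)\<^sup>2 \<partial>M) \<longlonglongrightarrow> 0"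
    by (rule Lim_null_comparison[OF always_eventually lim0]) (simp add: bound)
  have "(\<lambda>k. \<integral>\<omega>. Z \<omega> * ?E S k \<omega> \<partial>M) \<longlonglongrightarrow> (\<integral>\<omega>. Z \<omega> * J \<omega> \<partial>M)"
    by (rule integral_mult_limit[OF E2[OF ST(1)] J2 Z(2) l5])
  moreover have "(\<lambda>k. \<integral>\<omega>. Z \<omega> * ?E T k \<omega> \<partial>M) \<longlonglongrightarrow> (\<integral>\<omega>. Z \<omega> * I \<omega> \<partial>M)"
    by (rule integral_mult_limit[OF E2[OF T] I2 Z(2) l2])
  ultimately show ?thesis
    unfolding elementary_integral_martingale[OF e ST Z] by (blast intro: LIMSEQ_unique)
qed

end

section \<open>Second moments of linear equations\<close>

text \<open>
  An integrable solution is automatically continuous, hence differentiable, and \<open>f t * exp (- c * t)\<close>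
  has derivative \<open>0\<close>.
\<close>

lemma linear_integral_equation:
  fixes f :: "real \<Rightarrow> real"
  assumes int: "\<And>T. 0 \<le> T \<Longrightarrow> set_integrable lborel {0..T} f"
    and eq: "\<And>T. 0 \<le> T \<Longrightarrow> f T = a + c * (LINT t:{0..T}|lborel. f t)"
    and T: "0 \<le> T"
  shows "f T = a * exp (c * T)"
proof -
  have HK: "f integrable_on {0..t}" "f t = a + c * integral {0..t} f" if "0 \<le> t" for t
    using set_borel_integral_eq_integral[OF int[OF that]] eq[OF that] by auto
  have "continuous_on {0..T} (\<lambda>t. a + c * integral {0..t} f)"
    by (intro continuous_intros indefinite_integral_continuous_1 HK T)
  then have "continuous_on {0..T} f"
    by (rule continuous_on_eq) (simp add: HK(2))
  note der = integral_has_vector_derivative[OF this]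
  have f': "(f has_real_derivative c * f t) (at t within {0..T})" if "t \<in> {0..T}" for t
  proof -
    have "((\<lambda>t. a + c * integral {0..t} f) has_real_derivative c * f t) (at t within {0..T})"
      using der[OF that] by (auto intro!: derivative_eq_intros simp: has_real_derivative_iff_has_vector_derivative)
    then show ?thesis
      by (rule has_field_derivative_transform_within[of _ _ _ _ 1]) (use that HK(2) in auto)
  qed
  have "((\<lambda>t. f t * exp (- c * t)) has_real_derivative 0) (at t within {0..T})" if "t \<in> {0..T}" for t
    by (rule derivative_eq_intros refl f'[OF that] | simp)+
  then obtain d where d: "\<And>t. t \<in> {0..T} \<Longrightarrow> f t * exp (- c * t) = d"
    using has_field_derivative_zero_constant[of "{0..T}" "\<lambda>t. f t * exp (- c * t)"] by auto
  have "f 0 = a" using HK(2)[of 0] by simp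
  then have "f T * exp (- c * T) = a" using d[of 0] d[of T] T by simp
  then show ?thesis by (simp add: exp_minus field_simps)
qed

lemma square_primitive:
  fixes y :: "real \<Rightarrow> real"
  assumes y: "continuous_on {0..T} y" and T: "0 \<le> T"
  shows "(LINT t:{0..T}|lborel. y t)\<^sup>2 = 2 * (LINT t:{0..T}|lborel. y t * (LINT u:{0..t}|lborel. y u))"
proof -
  have HK: "(LINT u:{0..t}|lborel. y u) = integral {0..t} y" if "t \<in> {0..T}" for t
    using that by (intro set_borel_integral_eq_integral borel_integrable_atLeastAtMost' continuous_on_subset[OF y]) auto
  have A: "continuous_on {0..T} (\<lambda>t. integral {0..t} y)"
    by (intro indefinite_integral_continuous_1 integrable_continuous_interval y)
  have "((\<lambda>t. (integral {0..t} y)\<^sup>2) has_vector_derivative 2 * (y t * integral {0..t} y)) (at t within {0..T})"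
    if "t \<in> {0..T}" for t
    using integral_has_vector_derivative[OF y that]
    by (auto intro!: derivative_eq_intros simp flip: has_real_derivative_iff_has_vector_derivative)
  from fundamental_theorem_of_calculus[OF T this]
  have int: "((\<lambda>t. 2 * (y t * integral {0..t} y)) has_integral (integral {0..T} y)\<^sup>2) {0..T}"
    by simp
  have "(integral {0..T} y)\<^sup>2 = integral {0..T} (\<lambda>t. 2 * (y t * integral {0..t} y))"
    using integral_unique[OF int] by simp
  also have "\<dots> = 2 * integral {0..T} (\<lambda>t. y t * integral {0..t} y)" by simp
  also have "integral {0..T} (\<lambda>t. y t * integral {0..t} y) = (LINT t:{0..T}|lborel. y t * integral {0..t} y)"
    by (intro set_borel_integral_eq_integral(2)[symmetric] borel_integrable_atLeastAtMost' continuous_intros y A)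
  also have "\<dots> = (LINT t:{0..T}|lborel. y t * (LINT u:{0..t}|lborel. y u))"
    by (intro set_lebesgue_integral_cong) (auto simp: HK)
  finally show ?thesis using HK[of T] T by simp
qed

lemma indicator_square: "(indicator S t :: real)\<^sup>2 = indicator S t"
  by (simp split: split_indicator)

lemma integrable_interval_indicator: "integrable lborel (indicator {a..b :: real} :: real \<Rightarrow> real)"
  by (intro integrable_real_indicator) (auto simp: emeasure_lborel_Icc_eq)

text \<open>
  The equation \<open>Y = N + \<alpha> \<integral> Y\<close> for a martingale part \<open>N\<close> with \<open>E N(T)\<^sup>2 = x\<^sup>2 + q E \<integral>\<^sub>0\<^sup>T Y\<^sup>2\<close>. The
  martingale property enters as the orthogonality of \<open>Y S\<close> to \<open>N T - N S\<close>. That orthogonality is required only once \<open>Y S\<close> is known to be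
  square-integrable, which is itself a consequence of the equation.
\<close>

locale linear_drift_equation = prob_space M for M :: "'a measure" +
  fixes Y N :: "real \<Rightarrow> 'a \<Rightarrow> real" and \<alpha> q x :: real
  assumes Y_measurable: "(\<lambda>(t, \<omega>). Y t \<omega>) \<in> borel_measurable (lborel \<Otimes>\<^sub>M M)"
    and Y_continuous: "\<And>\<omega>. \<omega> \<in> space M \<Longrightarrow> continuous_on {0..} (\<lambda>t. Y t \<omega>)"
    and Y_square_integrable: "\<And>T. 0 \<le> T \<Longrightarrow> square_integrable (lborel \<Otimes>\<^sub>M M) (time_restricted T Y)"
    and N_square_integrable: "\<And>T. 0 \<le> T \<Longrightarrow> square_integrable M (N T)"
    and N_martingale: "\<And>S T. 0 \<le> S \<Longrightarrow> S \<le> T \<Longrightarrow> square_integrable M (Y S) \<Longrightarrow>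
      (\<integral>\<omega>. Y S \<omega> * N T \<omega> \<partial>M) = (\<integral>\<omega>. Y S \<omega> * N S \<omega> \<partial>M)"
    and N_second_moment: "\<And>T. 0 \<le> T \<Longrightarrow>
      (\<integral>\<omega>. (N T \<omega>)\<^sup>2 \<partial>M) = x\<^sup>2 + q * (\<integral>z. (time_restricted T Y z)\<^sup>2 \<partial>(lborel \<Otimes>\<^sub>M M))"
    and equation: "\<And>T. 0 \<le> T \<Longrightarrow> AE \<omega> in M. Y T \<omega> = N T \<omega> + \<alpha> * (LINT t:{0..T}|lborel. Y t \<omega>)"
begin

sublocale time: pair_sigma_finite "lborel :: real measure" M ..

definition area :: "real \<Rightarrow> 'a \<Rightarrow> real" where
  "area T \<omega> = (LINT t:{0..T}|lborel. Y t \<omega>)"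

lemma area_measurable_pair: "(\<lambda>(t, \<omega>). area t \<omega>) \<in> borel_measurable (lborel \<Otimes>\<^sub>M M)"
proof -
  let ?L = "lborel :: real measure"
  have "(\<lambda>z. \<integral>u. (\<lambda>(z, u). indicator {0..fst z} u * Y u (snd z)) (z, u) \<partial>?L) \<in> borel_measurable (?L \<Otimes>\<^sub>M M)"
  proof (rule lborel.borel_measurable_lebesgue_integral)
    have "(\<lambda>p. (snd p, snd (fst p))) \<in> (?L \<Otimes>\<^sub>M M) \<Otimes>\<^sub>M ?L \<rightarrow>\<^sub>M ?L \<Otimes>\<^sub>M M"
      by simp
    from measurable_compose[OF this Y_measurable]
    have "(\<lambda>p. Y (snd p) (snd (fst p))) \<in> borel_measurable ((?L \<Otimes>\<^sub>M M) \<Otimes>\<^sub>M ?L)"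
      by (simp add: split_beta')
    moreover have "(\<lambda>p. indicator {0..fst (fst p)} (snd p) :: real) \<in> borel_measurable ((?L \<Otimes>\<^sub>M M) \<Otimes>\<^sub>M ?L)"
      unfolding indicator_def of_bool_def atLeastAtMost_iff by measurable
    ultimately show "(\<lambda>(z, u). (\<lambda>(z, u). indicator {0..fst z} u * Y u (snd z)) (z, u))
        \<in> borel_measurable ((?L \<Otimes>\<^sub>M M) \<Otimes>\<^sub>M ?L)"
      by (simp add: split_beta')
  qed
  then show ?thesis by (simp add: area_def set_lebesgue_integral_def split_beta')
qed

lemma Y_measurable_M: "Y t \<in> borel_measurable M"
  using measurable_compose[OF measurable_Pair1'[of t lborel M] Y_measurable] by simp

lemma area_measurable: "area t \<in> borel_measurable M"
  using measurable_compose[OF measurable_Pair1'[of t lborel M] area_measurable_pair] by simp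

lemma Y_path_square_integrable:
  assumes "\<omega> \<in> space M"
  shows "square_integrable lborel (\<lambda>t. time_restricted T Y (t, \<omega>))"
proof -
  have c: "continuous_on {0..T} (\<lambda>t. Y t \<omega>)"
    by (rule continuous_on_subset[OF Y_continuous[OF assms]]) auto
  have "set_integrable lborel {0..T} (\<lambda>t. (Y t \<omega>)\<^sup>2)"
    by (intro borel_integrable_atLeastAtMost' continuous_intros c)
  moreover have "(\<lambda>t. (time_restricted T Y (t, \<omega>))\<^sup>2) = (\<lambda>t. indicator {0..T} t * (Y t \<omega>)\<^sup>2)"
    by (auto simp: time_restricted_def split: split_indicator)
  moreover have "set_integrable lborel {0..T} (\<lambda>t. Y t \<omega>)"
    by (intro borel_integrable_atLeastAtMost' c)
  then have "(\<lambda>t. time_restricted T Y (t, \<omega>)) \<in> borel_measurable lborel"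
    by (auto simp: set_integrable_def time_restricted_def)
  ultimately show ?thesis
    by (simp add: square_integrable_def set_integrable_def)
qed

text \<open>
  The Cauchy-Schwarz inequality against the indicator of \<open>[0, t]\<close>. The bound does not depend on
  \<open>t \<le> T\<close>, so it controls \<open>area\<close> both at a fixed time and on the product space.
\<close>

lemma area_square_le:
  assumes "\<omega> \<in> space M" "0 \<le> t" "t \<le> T"
  shows "(area t \<omega>)\<^sup>2 \<le> T * (\<integral>u. (time_restricted T Y (u, \<omega>))\<^sup>2 \<partial>lborel)"
proof -
  have 1: "square_integrable lborel (indicator {0..t} :: real \<Rightarrow> real)"
    using assms(2) by (simp add: square_integrable_def integrable_interval_indicator indicator_square)
  have "area t \<omega> = (\<integral>u. indicator {0..t} u * time_restricted T Y (u, \<omega>) \<partial>lborel)"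
    unfolding area_def set_lebesgue_integral_def using assms
    by (intro Bochner_Integration.integral_cong) (auto simp: time_restricted_def split: split_indicator)
  then have "(area t \<omega>)\<^sup>2 \<le> (\<integral>u. (indicator {0..t} u)\<^sup>2 \<partial>lborel) * (\<integral>u. (time_restricted T Y (u, \<omega>))\<^sup>2 \<partial>lborel)"
    using integral_Cauchy_Schwarz[OF 1 Y_path_square_integrable[OF assms(1), of T]] by simp
  also have "(\<integral>u. (indicator {0..t} u)\<^sup>2 \<partial>lborel) = t"
    using assms(2) by (simp add: indicator_square)
  also have "t * (\<integral>u. (time_restricted T Y (u, \<omega>))\<^sup>2 \<partial>lborel) \<le> T * (\<integral>u. (time_restricted T Y (u, \<omega>))\<^sup>2 \<partial>lborel)"
    using assms(3) by (intro mult_right_mono) auto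
  finally show ?thesis .
qed

lemma path_energy_integrable:
  assumes "0 \<le> T"
  shows "integrable M (\<lambda>\<omega>. T * (\<integral>u. (time_restricted T Y (u, \<omega>))\<^sup>2 \<partial>lborel))"
  using time.integrable_snd[of "\<lambda>u \<omega>. (time_restricted T Y (u, \<omega>))\<^sup>2"] square_integrableD[OF Y_square_integrable[OF assms]]
  by (simp add: split_beta')

lemma area_square_integrable:
  assumes "0 \<le> T"
  shows "square_integrable M (area T)"
  unfolding square_integrable_def
proof
  show "area T \<in> borel_measurable M" by (rule area_measurable)
  show "integrable M (\<lambda>\<omega>. (area T \<omega>)\<^sup>2)"
  proof (rule Bochner_Integration.integrable_bound[OF path_energy_integrable[OF assms]])
    show "AE \<omega> in M. norm ((area T \<omega>)\<^sup>2) \<le> norm (T * (\<integral>u. (time_restricted T Y (u, \<omega>))\<^sup>2 \<partial>lborel))"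
      using area_square_le[OF _ assms order_refl] assms by (intro AE_I2) simp
  qed (use area_measurable in simp)
qed

lemma equation_area: "0 \<le> T \<Longrightarrow> AE \<omega> in M. Y T \<omega> = N T \<omega> + \<alpha> * area T \<omega>"
  using equation by (simp add: area_def)

lemma Y_marginal_square_integrable:
  assumes "0 \<le> T"
  shows "square_integrable M (Y T)"
proof (rule square_integrable_cong_AE)
  show "square_integrable M (\<lambda>\<omega>. N T \<omega> + \<alpha> * area T \<omega>)"
    by (intro square_integrable_add square_integrable_cmult N_square_integrable area_square_integrable assms)
  show "AE \<omega> in M. N T \<omega> + \<alpha> * area T \<omega> = Y T \<omega>"
    using equation_area[OF assms] by eventually_elim simp
qed (rule Y_measurable_M)

lemma time_restricted_area_square_integrable:
  assumes T: "0 \<le> T"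
  shows "square_integrable (lborel \<Otimes>\<^sub>M M) (time_restricted T area)"
  unfolding square_integrable_def
proof
  show m: "time_restricted T area \<in> borel_measurable (lborel \<Otimes>\<^sub>M M)"
    using area_measurable_pair by (simp add: time_restricted_def split_beta')
  show "integrable (lborel \<Otimes>\<^sub>M M) (\<lambda>z. (time_restricted T area z)\<^sup>2)"
  proof (rule Bochner_Integration.integrable_bound)
    show "integrable (lborel \<Otimes>\<^sub>M M)
        (\<lambda>(t, \<omega>). indicator {0..T} t * (T * (\<integral>u. (time_restricted T Y (u, \<omega>))\<^sup>2 \<partial>lborel)))"
      by (intro time.integrable_pair_mult path_energy_integrable[OF T] integrable_interval_indicator)
    show "AE z in lborel \<Otimes>\<^sub>M M. norm ((time_restricted T area z)\<^sup>2)
        \<le> norm (case z of (t, \<omega>) \<Rightarrow> indicator {0..T} t * (T * (\<integral>u. (time_restricted T Y (u, \<omega>))\<^sup>2 \<partial>lborel)))"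
      using area_square_le T
      by (intro AE_I2) (auto simp: time_restricted_def space_pair_measure split: split_indicator)
  qed (use m in simp)
qed

text \<open>
  Interchange expectation and time integral, move \<open>N\<close> from \<open>T\<close> back to \<open>t\<close> by the martingale property,
  and substitute \<open>N t = Y t - \<alpha> * area t\<close>.
\<close>

lemma expectation_area_mult_N:
  assumes T: "0 \<le> T"
  shows "(\<integral>\<omega>. area T \<omega> * N T \<omega> \<partial>M) =
      (\<integral>t. indicator {0..T} t * ((\<integral>\<omega>. (Y t \<omega>)\<^sup>2 \<partial>M) - \<alpha> * (\<integral>\<omega>. Y t \<omega> * area t \<omega> \<partial>M)) \<partial>lborel)"
proof -
  have [measurable]: "N T \<in> borel_measurable M"
    using N_square_integrable[OF T] by (rule square_integrable_measurable)
  have "(\<lambda>(t, \<omega>). indicator {0..T} t * (N T \<omega>)\<^sup>2) = (\<lambda>z. (time_restricted T (\<lambda>t. N T) z)\<^sup>2)"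
    by (auto simp: time_restricted_def fun_eq_iff split: split_indicator)
  moreover have "integrable (lborel \<Otimes>\<^sub>M M) (\<lambda>(t, \<omega>). indicator {0..T} t * (N T \<omega>)\<^sup>2)"
    by (intro time.integrable_pair_mult square_integrableD N_square_integrable T integrable_interval_indicator)
  moreover have "time_restricted T (\<lambda>t. N T) \<in> borel_measurable (lborel \<Otimes>\<^sub>M M)"
    by (simp add: time_restricted_def)
  ultimately have "square_integrable (lborel \<Otimes>\<^sub>M M) (time_restricted T (\<lambda>t. N T))"
    by (simp add: square_integrable_def)
  from square_integrable_mult_integrable[OF Y_square_integrable[OF T] this]
  have int: "integrable (lborel \<Otimes>\<^sub>M M) (\<lambda>(t, \<omega>). time_restricted T Y (t, \<omega>) * N T \<omega>)"
    by (rule Bochner_Integration.integrable_cong[THEN iffD1, rotated -1])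
       (auto simp: time_restricted_def split: split_indicator)
  have "(\<integral>\<omega>. area T \<omega> * N T \<omega> \<partial>M) = (\<integral>\<omega>. (\<integral>t. time_restricted T Y (t, \<omega>) * N T \<omega> \<partial>lborel) \<partial>M)"
    by (simp add: area_def set_lebesgue_integral_def time_restricted_def)
  also have "\<dots> = (\<integral>t. (\<integral>\<omega>. time_restricted T Y (t, \<omega>) * N T \<omega> \<partial>M) \<partial>lborel)"
    by (rule time.Fubini_integral[OF int])
  also have "\<dots> = (\<integral>t. indicator {0..T} t * ((\<integral>\<omega>. (Y t \<omega>)\<^sup>2 \<partial>M) - \<alpha> * (\<integral>\<omega>. Y t \<omega> * area t \<omega> \<partial>M)) \<partial>lborel)"
  proof (rule Bochner_Integration.integral_cong[OF refl])
    fix t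
    show "(\<integral>\<omega>. time_restricted T Y (t, \<omega>) * N T \<omega> \<partial>M)
        = indicator {0..T} t * ((\<integral>\<omega>. (Y t \<omega>)\<^sup>2 \<partial>M) - \<alpha> * (\<integral>\<omega>. Y t \<omega> * area t \<omega> \<partial>M))"
    proof (cases "t \<in> {0..T}")
      case True
      then have t: "0 \<le> t" "t \<le> T" by auto
      note Yt = Y_marginal_square_integrable[OF t(1)] and At = area_square_integrable[OF t(1)]
      have "(\<integral>\<omega>. Y t \<omega> * N T \<omega> \<partial>M) = (\<integral>\<omega>. Y t \<omega> * N t \<omega> \<partial>M)"
        by (rule N_martingale[OF t Yt])
      also have "\<dots> = (\<integral>\<omega>. (Y t \<omega>)\<^sup>2 - \<alpha> * (Y t \<omega> * area t \<omega>) \<partial>M)"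
      proof (rule integral_cong_AE)
        show "AE \<omega> in M. Y t \<omega> * N t \<omega> = (Y t \<omega>)\<^sup>2 - \<alpha> * (Y t \<omega> * area t \<omega>)"
          using equation_area[OF t(1)]
        proof eventually_elim
          case (elim \<omega>)
          then have "N t \<omega> = Y t \<omega> - \<alpha> * area t \<omega>" by simp
          then show ?case by (simp only:) (simp add: power2_eq_square algebra_simps)
        qed
      qed (use Y_measurable_M area_measurable square_integrable_measurable[OF N_square_integrable[OF t(1)]] in auto)
      also have "\<dots> = (\<integral>\<omega>. (Y t \<omega>)\<^sup>2 \<partial>M) - (\<integral>\<omega>. \<alpha> * (Y t \<omega> * area t \<omega>) \<partial>M)"
        using square_integrable_mult_integrable[OF Yt At]
        by (intro Bochner_Integration.integral_diff square_integrableD[OF Yt]) auto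
      finally show ?thesis using True by (simp add: time_restricted_def)
    qed (simp add: time_restricted_def)
  qed
  finally show ?thesis .
qed

lemma Y_area_integrable:
  assumes T: "0 \<le> T"
  shows "integrable (lborel \<Otimes>\<^sub>M M) (\<lambda>(t, \<omega>). indicator {0..T} t * (Y t \<omega> * area t \<omega>))"
  by (rule Bochner_Integration.integrable_cong[THEN iffD1, OF refl _
        square_integrable_mult_integrable[OF Y_square_integrable[OF T] time_restricted_area_square_integrable[OF T]]])
     (auto simp: time_restricted_def split: split_indicator)

lemma expectation_area_square:
  assumes T: "0 \<le> T"
  shows "(\<integral>\<omega>. (area T \<omega>)\<^sup>2 \<partial>M) = 2 * (\<integral>t. indicator {0..T} t * (\<integral>\<omega>. Y t \<omega> * area t \<omega> \<partial>M) \<partial>lborel)"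
proof -
  have "(\<integral>\<omega>. (area T \<omega>)\<^sup>2 \<partial>M) = (\<integral>\<omega>. 2 * (\<integral>t. indicator {0..T} t * (Y t \<omega> * area t \<omega>) \<partial>lborel) \<partial>M)"
  proof (rule Bochner_Integration.integral_cong[OF refl])
    fix \<omega> assume "\<omega> \<in> space M"
    then have "continuous_on {0..T} (\<lambda>t. Y t \<omega>)"
      by (intro continuous_on_subset[OF Y_continuous]) auto
    from square_primitive[OF this T]
    show "(area T \<omega>)\<^sup>2 = 2 * (\<integral>t. indicator {0..T} t * (Y t \<omega> * area t \<omega>) \<partial>lborel)"
      by (simp add: area_def set_lebesgue_integral_def)
  qed
  also have "\<dots> = 2 * (\<integral>t. (\<integral>\<omega>. indicator {0..T} t * (Y t \<omega> * area t \<omega>) \<partial>M) \<partial>lborel)"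
    using time.Fubini_integral[OF Y_area_integrable[OF T]] by simp
  finally show ?thesis by simp
qed

lemma second_moment_integrable:
  assumes T: "0 \<le> T"
  shows "set_integrable lborel {0..T} (\<lambda>t. \<integral>\<omega>. (Y t \<omega>)\<^sup>2 \<partial>M)"
    and "(\<integral>z. (time_restricted T Y z)\<^sup>2 \<partial>(lborel \<Otimes>\<^sub>M M)) = (LINT t:{0..T}|lborel. (\<integral>\<omega>. (Y t \<omega>)\<^sup>2 \<partial>M))"
proof -
  note int = square_integrableD[OF Y_square_integrable[OF T]]
  have eq: "(\<integral>\<omega>. (time_restricted T Y (t, \<omega>))\<^sup>2 \<partial>M) = indicator {0..T} t * (\<integral>\<omega>. (Y t \<omega>)\<^sup>2 \<partial>M)" for t
    by (auto simp: time_restricted_def split: split_indicator)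
  show "set_integrable lborel {0..T} (\<lambda>t. \<integral>\<omega>. (Y t \<omega>)\<^sup>2 \<partial>M)"
    using time.integrable_fst'[OF int] by (simp add: eq set_integrable_def)
  show "(\<integral>z. (time_restricted T Y z)\<^sup>2 \<partial>(lborel \<Otimes>\<^sub>M M)) = (LINT t:{0..T}|lborel. (\<integral>\<omega>. (Y t \<omega>)\<^sup>2 \<partial>M))"
    using time.integral_fst'[OF int] by (simp add: eq set_lebesgue_integral_def)
qed

text \<open>
  Expand the square of \<open>N T + \<alpha> * area T\<close>. With \<open>\<beta> = \<integral>\<^sub>0\<^sup>T E (Y t * area t) dt\<close> the mixed term contributes
  \<open>- 2 * \<alpha>\<^sup>2 * \<beta>\<close> and the square of the drift part \<open>+ 2 * \<alpha>\<^sup>2 * \<beta>\<close>: the unknown \<open>\<beta>\<close> cancels.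
\<close>

lemma second_moment_equation:
  assumes T: "0 \<le> T"
  shows "(\<integral>\<omega>. (Y T \<omega>)\<^sup>2 \<partial>M) = x\<^sup>2 + (q + 2 * \<alpha>) * (LINT t:{0..T}|lborel. (\<integral>\<omega>. (Y t \<omega>)\<^sup>2 \<partial>M))"
proof -
  note N2 = N_square_integrable[OF T] and A2 = area_square_integrable[OF T]
  define G where "G = (\<integral>t. indicator {0..T} t * (\<integral>\<omega>. (Y t \<omega>)\<^sup>2 \<partial>M) \<partial>lborel)"
  define \<beta> where "\<beta> = (\<integral>t. indicator {0..T} t * (\<integral>\<omega>. Y t \<omega> * area t \<omega> \<partial>M) \<partial>lborel)"
  have Gint: "integrable lborel (\<lambda>t. indicator {0..T} t * (\<integral>\<omega>. (Y t \<omega>)\<^sup>2 \<partial>M))"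
    using second_moment_integrable(1)[OF T] by (simp add: set_integrable_def)
  have \<beta>int: "integrable lborel (\<lambda>t. indicator {0..T} t * (\<integral>\<omega>. Y t \<omega> * area t \<omega> \<partial>M))"
    using time.integrable_fst'[OF Y_area_integrable[OF T]] by simp
  have "(\<integral>\<omega>. area T \<omega> * N T \<omega> \<partial>M)
      = (\<integral>t. indicator {0..T} t * (\<integral>\<omega>. (Y t \<omega>)\<^sup>2 \<partial>M) - \<alpha> * (indicator {0..T} t * (\<integral>\<omega>. Y t \<omega> * area t \<omega> \<partial>M)) \<partial>lborel)"
    unfolding expectation_area_mult_N[OF T]
    by (intro Bochner_Integration.integral_cong refl) (simp add: algebra_simps)
  also have "\<dots> = G - \<alpha> * \<beta>"
    using Gint \<beta>int by (subst Bochner_Integration.integral_diff) (auto simp: G_def \<beta>_def)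
  finally have AN: "(\<integral>\<omega>. area T \<omega> * N T \<omega> \<partial>M) = G - \<alpha> * \<beta>" .
  have AA: "(\<integral>\<omega>. (area T \<omega>)\<^sup>2 \<partial>M) = 2 * \<beta>"
    unfolding \<beta>_def by (rule expectation_area_square[OF T])
  have NN: "(\<integral>\<omega>. (N T \<omega>)\<^sup>2 \<partial>M) = x\<^sup>2 + q * G"
    unfolding N_second_moment[OF T] second_moment_integrable(2)[OF T]
    by (simp add: G_def set_lebesgue_integral_def)
  have "(\<integral>\<omega>. (Y T \<omega>)\<^sup>2 \<partial>M) = (\<integral>\<omega>. (N T \<omega> - (- \<alpha>) * area T \<omega>)\<^sup>2 \<partial>M)"
  proof (rule integral_cong_AE)
    show "AE \<omega> in M. (Y T \<omega>)\<^sup>2 = (N T \<omega> - (- \<alpha>) * area T \<omega>)\<^sup>2"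
      using equation_area[OF T] by eventually_elim simp
  qed (use Y_measurable_M area_measurable square_integrable_measurable[OF N2] in auto)
  also have "\<dots> = (\<integral>\<omega>. (N T \<omega>)\<^sup>2 \<partial>M) - 2 * (\<integral>\<omega>. (- \<alpha>) * (area T \<omega> * N T \<omega>) \<partial>M) + (\<integral>\<omega>. \<alpha>\<^sup>2 * (area T \<omega>)\<^sup>2 \<partial>M)"
    by (subst integral_square_diff[OF N2 square_integrable_cmult[OF A2]])
       (simp add: power_mult_distrib mult_ac)
  also have "\<dots> = x\<^sup>2 + q * G + 2 * \<alpha> * (G - \<alpha> * \<beta>) + \<alpha>\<^sup>2 * (2 * \<beta>)"
    by (simp add: AN AA NN)
  also have "\<dots> = x\<^sup>2 + (q + 2 * \<alpha>) * G" by (simp add: power2_eq_square algebra_simps)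
  finally show ?thesis by (simp add: G_def set_lebesgue_integral_def)
qed

theorem second_moment:
  assumes "0 \<le> T"
  shows "(\<integral>\<omega>. (Y T \<omega>)\<^sup>2 \<partial>M) = x\<^sup>2 * exp ((q + 2 * \<alpha>) * T)"
  by (rule linear_integral_equation[OF second_moment_integrable(1) second_moment_equation assms])

end

section \<open>Geometric Brownian motion\<close>

lemma integrable_exp_Ici:
  assumes "0 < l"
  shows "integrable lborel (\<lambda>t. indicator {0..} t * exp (- l * t) :: real)"
proof -
  have "(\<integral>\<^sup>+t. ennreal (exponential_density l t) \<partial>lborel) = 1"
    using prob_space.emeasure_space_1[OF prob_space_exponential_density[OF assms]]
    by (simp add: emeasure_density)
  then have "integrable lborel (exponential_density l)"
    using exponential_density_nonneg[OF assms] by (intro integrableI_nonneg) auto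
  then have "integrable lborel (\<lambda>t. (1 / l) * exponential_density l t)" by simp
  moreover have "(\<lambda>t. (1 / l) * exponential_density l t) = (\<lambda>t. indicator {0..} t * exp (- l * t))"
    using assms by (auto simp: exponential_density_def fun_eq_iff mult.commute split: split_indicator)
  ultimately show ?thesis by simp
qed

locale geometric_brownian = brownian_filtration M F W
  for M :: "'a measure" and F :: "ennreal \<Rightarrow> 'a measure" and W :: "real \<Rightarrow> 'a \<Rightarrow> real" +
  fixes \<alpha> \<sigma> x :: real and X :: "real \<Rightarrow> 'a \<Rightarrow> real"
  assumes gbm: "geometric_brownian_motion M F W \<alpha> \<sigma> x X" and volatility_pos: "0 < \<sigma>"
begin

definition continuous_paths :: "'a set" where
  "continuous_paths = {\<omega> \<in> space M. continuous_on {0..} (\<lambda>t. X t \<omega>)}"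

text \<open>
  A version of \<open>X\<close> all of whose paths are continuous. It stays adapted because the exceptional null set
  belongs to the initial \<open>\<sigma>\<close>-algebra.
\<close>

definition Y :: "real \<Rightarrow> 'a \<Rightarrow> real" where
  "Y t \<omega> = (if 0 \<le> t then indicator continuous_paths \<omega> * X t \<omega> else 0)"

lemma AE_continuous_paths: "AE \<omega> in M. \<omega> \<in> continuous_paths"
proof -
  have "AE \<omega> in M. continuous_on {0..} (\<lambda>t. X t \<omega>)"
    using gbm by (simp add: geometric_brownian_motion_def sde_solution_def)
  then show ?thesis by (rule AE_mp) (auto simp: continuous_paths_def intro!: AE_I2)
qed

lemma continuous_paths_sets_F: "continuous_paths \<in> sets (F t)"
proof -
  have "space M - continuous_paths \<in> null_sets M"
    using AE_continuous_paths unfolding AE_iff_null_sets by (simp add: set_diff_eq)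
  then have "space M - continuous_paths \<in> sets (F t)"
    using null_sets_F sets_F_mono[of 0 t] by auto
  then have "space M - (space M - continuous_paths) \<in> sets (F t)"
    using sets.compl_sets[of "space M - continuous_paths" "F t"] by (simp add: space_F)
  moreover have "space M - (space M - continuous_paths) = continuous_paths" by (auto simp: continuous_paths_def)
  ultimately show ?thesis by simp
qed

lemma continuous_paths_sets: "continuous_paths \<in> sets M"
  using continuous_paths_sets_F[of 0] subalgebra_F[of 0] by (auto simp: subalgebra_def)

lemma AE_Y_eq: "AE \<omega> in M. \<forall>t\<ge>0. Y t \<omega> = X t \<omega>"
  using AE_continuous_paths by eventually_elim (simp add: Y_def)

lemma Y_continuous: "continuous_on {0..} (\<lambda>t. Y t \<omega>)"
proof (cases "\<omega> \<in> continuous_paths")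
  case True
  then have "continuous_on {0..} (\<lambda>t. X t \<omega>)" by (simp add: continuous_paths_def)
  then show ?thesis by (rule continuous_on_eq) (use True in \<open>simp add: Y_def\<close>)
next
  case False
  then have "(\<lambda>t. Y t \<omega>) = (\<lambda>_. 0)" by (auto simp: Y_def)
  then show ?thesis by (simp only: continuous_on_const)
qed

lemma Y_measurable_F:
  assumes "0 \<le> t"
  shows "Y t \<in> borel_measurable (F (ennreal t))"
proof -
  have [measurable]: "X t \<in> borel_measurable (F (ennreal t))" "continuous_paths \<in> sets (F (ennreal t))"
    using gbm assms continuous_paths_sets_F by (auto simp: geometric_brownian_motion_def sde_solution_def adapted_def)
  have "(\<lambda>\<omega>. indicator continuous_paths \<omega> * X t \<omega>) \<in> borel_measurable (F (ennreal t))" by measurable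
  then show ?thesis using assms by (simp add: Y_def[abs_def])
qed

lemma ito_representation:
  obtains I where "\<And>T. 0 \<le> T \<Longrightarrow> has_ito_integral M F W (\<lambda>t \<omega>. \<sigma> * X t \<omega>) T (I T)"
    "\<And>T. 0 \<le> T \<Longrightarrow> AE \<omega> in M. X T \<omega> = x + (LINT t:{0..T}|lborel. \<alpha> * X t \<omega>) + I T \<omega>"
proof -
  have "\<forall>T. 0 \<le> T \<longrightarrow> (\<exists>I. has_ito_integral M F W (\<lambda>t \<omega>. \<sigma> * X t \<omega>) T I \<and>
             (AE \<omega> in M. X T \<omega> = x + (LINT t:{0..T}|lborel. \<alpha> * X t \<omega>) + I \<omega>))"
    using gbm by (simp add: geometric_brownian_motion_def sde_solution_def)
  then obtain I where "\<forall>T\<ge>0. has_ito_integral M F W (\<lambda>t \<omega>. \<sigma> * X t \<omega>) T (I T) \<and>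
             (AE \<omega> in M. X T \<omega> = x + (LINT t:{0..T}|lborel. \<alpha> * X t \<omega>) + I T \<omega>)"
    by (subst (asm) choice_iff') blast
  then show ?thesis using that by blast
qed

lemma X_square_integrable:
  assumes "0 \<le> T"
  shows "square_integrable (lborel \<Otimes>\<^sub>M M) (time_restricted T X)"
proof -
  obtain I where "\<And>T. 0 \<le> T \<Longrightarrow> has_ito_integral M F W (\<lambda>t \<omega>. \<sigma> * X t \<omega>) T (I T)"
    by (rule ito_representation) blast
  from square_integrable_cmult[OF ito_integral_square_integrable(2)[OF this[OF assms] assms], of "1 / \<sigma>"]
  show ?thesis using volatility_pos by (simp add: time_restricted_def split_beta')
qed

text \<open>
  Joint measurability is available on each \<open>[0, n]\<close>, as part of the integrability of \<open>\<sigma> X\<close>; let \<open>n\<close>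
  tend to infinity.
\<close>

lemma Y_measurable: "(\<lambda>(t, \<omega>). Y t \<omega>) \<in> borel_measurable (lborel \<Otimes>\<^sub>M M)"
proof (rule borel_measurable_LIMSEQ_real)
  fix n :: nat
  have [measurable]: "time_restricted (real n) X \<in> borel_measurable (lborel \<Otimes>\<^sub>M M)" "continuous_paths \<in> sets M"
    using X_square_integrable[of "real n"] continuous_paths_sets by (auto simp: square_integrable_def)
  show "(\<lambda>z. indicator continuous_paths (snd z) * time_restricted (real n) X z) \<in> borel_measurable (lborel \<Otimes>\<^sub>M M)"
    by measurable
next
  fix z :: "real \<times> 'a" assume "z \<in> space (lborel \<Otimes>\<^sub>M M)"
  obtain t \<omega> where z: "z = (t, \<omega>)" by (cases z)
  have "\<forall>\<^sub>F n in sequentially. indicator continuous_paths (snd z) * time_restricted (real n) X z = (case z of (t, \<omega>) \<Rightarrow> Y t \<omega>)"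
    using eventually_ge_at_top[of "nat \<lceil>t\<rceil>"]
  proof eventually_elim
    case (elim n)
    then have "t \<le> real n" by linarith
    then show ?case by (auto simp: z time_restricted_def Y_def split: split_indicator)
  qed
  then show "(\<lambda>n. indicator continuous_paths (snd z) * time_restricted (real n) X z) \<longlonglongrightarrow> (case z of (t, \<omega>) \<Rightarrow> Y t \<omega>)"
    by (rule tendsto_eventually)
qed

lemma time_restricted_Y: "time_restricted T Y = (\<lambda>z. indicator continuous_paths (snd z) * time_restricted T X z)"
  by (auto simp: time_restricted_def Y_def fun_eq_iff split: split_indicator)

lemma Y_square_integrable:
  assumes "0 \<le> T"
  shows "square_integrable (lborel \<Otimes>\<^sub>M M) (time_restricted T Y)"
  unfolding time_restricted_Y
proof (rule square_integrable_bounded_mult[OF X_square_integrable[OF assms]])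
  have [measurable]: "continuous_paths \<in> sets M" by (rule continuous_paths_sets)
  show "(\<lambda>z. indicator continuous_paths (snd z)) \<in> borel_measurable (lborel \<Otimes>\<^sub>M M)" by measurable
qed (rule indicator_abs_le_1)

lemma X_energy_eq:
  assumes "0 \<le> T"
  shows "(\<integral>z. (time_restricted T X z)\<^sup>2 \<partial>(lborel \<Otimes>\<^sub>M M)) = (\<integral>z. (time_restricted T Y z)\<^sup>2 \<partial>(lborel \<Otimes>\<^sub>M M))"
proof (rule time.integral_cong_AE_snd)
  show "AE \<omega> in M. \<forall>t. (time_restricted T X (t, \<omega>))\<^sup>2 = (time_restricted T Y (t, \<omega>))\<^sup>2"
    using AE_continuous_paths by eventually_elim (simp add: time_restricted_Y)
qed (intro square_integrableD X_square_integrable Y_square_integrable assms)+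

lemma square_integrable_const: "square_integrable M (\<lambda>_. c)"
  by (simp add: square_integrable_def)

lemma second_moment_Y:
  assumes T: "0 \<le> T"
  shows "square_integrable M (Y T)" "(\<integral>\<omega>. (Y T \<omega>)\<^sup>2 \<partial>M) = x\<^sup>2 * exp ((\<sigma>\<^sup>2 + 2 * \<alpha>) * T)"
proof -
  obtain I where I: "\<And>T. 0 \<le> T \<Longrightarrow> has_ito_integral M F W (\<lambda>t \<omega>. \<sigma> * X t \<omega>) T (I T)"
    and X: "\<And>T. 0 \<le> T \<Longrightarrow> AE \<omega> in M. X T \<omega> = x + (LINT t:{0..T}|lborel. \<alpha> * X t \<omega>) + I T \<omega>"
    by (rule ito_representation) blast
  note I2 = ito_integral_square_integrable(1)[OF I]
  interpret linear_drift_equation M Y "\<lambda>T \<omega>. x + I T \<omega>" \<alpha> "\<sigma>\<^sup>2" x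
  proof
    show "(\<lambda>(t, \<omega>). Y t \<omega>) \<in> borel_measurable (lborel \<Otimes>\<^sub>M M)" by (rule Y_measurable)
    show "continuous_on {0..} (\<lambda>t. Y t \<omega>)" for \<omega> by (rule Y_continuous)
  next
    fix T :: real assume T: "0 \<le> T"
    show "square_integrable (lborel \<Otimes>\<^sub>M M) (time_restricted T Y)" by (rule Y_square_integrable[OF T])
    show "square_integrable M (\<lambda>\<omega>. x + I T \<omega>)"
      by (intro square_integrable_add square_integrable_const I2 T)
    have "(\<integral>\<omega>. (x + I T \<omega>)\<^sup>2 \<partial>M) = (\<integral>\<omega>. (I T \<omega> - (- x))\<^sup>2 \<partial>M)" by (simp add: add.commute)
    also have "\<dots> = (\<integral>\<omega>. (I T \<omega>)\<^sup>2 \<partial>M) + x\<^sup>2"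
      by (subst integral_square_diff[OF I2[OF T T] square_integrable_const])
         (simp add: prob_space ito_integral_mean[OF I[OF T] T])
    also have "(\<integral>\<omega>. (I T \<omega>)\<^sup>2 \<partial>M) = (\<integral>z. (time_restricted T (\<lambda>t \<omega>. \<sigma> * X t \<omega>) z)\<^sup>2 \<partial>(lborel \<Otimes>\<^sub>M M))"
      by (rule ito_isometry[OF I[OF T] T])
    also have "\<dots> = (\<integral>z. \<sigma>\<^sup>2 * (time_restricted T X z)\<^sup>2 \<partial>(lborel \<Otimes>\<^sub>M M))"
      by (intro Bochner_Integration.integral_cong refl)
         (auto simp: time_restricted_def power_mult_distrib)
    also have "\<dots> = \<sigma>\<^sup>2 * (\<integral>z. (time_restricted T Y z)\<^sup>2 \<partial>(lborel \<Otimes>\<^sub>M M))"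
      by (simp add: X_energy_eq[OF T])
    finally show "(\<integral>\<omega>. (x + I T \<omega>)\<^sup>2 \<partial>M) = x\<^sup>2 + \<sigma>\<^sup>2 * (\<integral>z. (time_restricted T Y z)\<^sup>2 \<partial>(lborel \<Otimes>\<^sub>M M))"
      by simp
    show "AE \<omega> in M. Y T \<omega> = x + I T \<omega> + \<alpha> * (LINT t:{0..T}|lborel. Y t \<omega>)"
      using X[OF T] AE_Y_eq
    proof eventually_elim
      case (elim \<omega>)
      have "(LINT t:{0..T}|lborel. Y t \<omega>) = (LINT t:{0..T}|lborel. X t \<omega>)"
        using elim(2) by (intro set_lebesgue_integral_cong) auto
      then show ?case using elim T by simp
    qed
  next
    fix S T :: real assume ST: "0 \<le> S" "S \<le> T" and YS: "square_integrable M (Y S)"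
    have int: "integrable M (\<lambda>\<omega>. Y S \<omega> * x)" "integrable M (\<lambda>\<omega>. Y S \<omega> * I R \<omega>)" if "0 \<le> R" for R
      using that by (intro square_integrable_mult_integrable YS square_integrable_const I2; simp)+
    have "(\<integral>\<omega>. Y S \<omega> * I T \<omega> \<partial>M) = (\<integral>\<omega>. Y S \<omega> * I S \<omega> \<partial>M)"
      using ST by (intro ito_integral_martingale[OF I I] Y_measurable_F YS) auto
    moreover have "(\<integral>\<omega>. Y S \<omega> * (x + I R \<omega>) \<partial>M) = (\<integral>\<omega>. Y S \<omega> * x \<partial>M) + (\<integral>\<omega>. Y S \<omega> * I R \<omega> \<partial>M)" if "0 \<le> R" for R
      unfolding distrib_left using int[OF that] by (rule Bochner_Integration.integral_add)
    ultimately show "(\<integral>\<omega>. Y S \<omega> * (x + I T \<omega>) \<partial>M) = (\<integral>\<omega>. Y S \<omega> * (x + I S \<omega>) \<partial>M)"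
      using ST by simp
  qed
  show "square_integrable M (Y T)" by (rule Y_marginal_square_integrable[OF T])
  show "(\<integral>\<omega>. (Y T \<omega>)\<^sup>2 \<partial>M) = x\<^sup>2 * exp ((\<sigma>\<^sup>2 + 2 * \<alpha>) * T)" by (rule second_moment[OF T])
qed

text \<open>
  This is where the standing assumption on the interest rate is used: the expectation at time \<open>t\<close>
  decays like \<open>exp (- (r - (\<sigma>\<^sup>2 + 2 * \<alpha>)) * t)\<close>.
\<close>

lemma discounted_square_integrable:
  assumes r: "\<sigma>\<^sup>2 + 2 * \<alpha> < r"
  shows "integrable (lborel \<Otimes>\<^sub>M M) (\<lambda>(t, \<omega>). indicator {0..} t * exp (- r * t) * (Y t \<omega>)\<^sup>2)"
proof (rule time.Fubini_integrable)
  show "(\<lambda>(t, \<omega>). indicator {0..} t * exp (- r * t) * (Y t \<omega>)\<^sup>2) \<in> borel_measurable (lborel \<Otimes>\<^sub>M M)"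
    using Y_measurable by (simp add: split_beta')
  have "(\<integral>\<omega>. norm (case (t, \<omega>) of (t, \<omega>) \<Rightarrow> indicator {0..} t * exp (- r * t) * (Y t \<omega>)\<^sup>2) \<partial>M)
      = x\<^sup>2 * (indicator {0..} t * exp (- (r - (\<sigma>\<^sup>2 + 2 * \<alpha>)) * t))" for t
    by (cases "0 \<le> t") (auto simp: abs_mult second_moment_Y(2) algebra_simps simp flip: exp_add)
  note norm_eq = this
  show "integrable lborel (\<lambda>t. \<integral>\<omega>. norm (case (t, \<omega>) of (t, \<omega>) \<Rightarrow> indicator {0..} t * exp (- r * t) * (Y t \<omega>)\<^sup>2) \<partial>M)"
    unfolding norm_eq using integrable_exp_Ici[of "r - (\<sigma>\<^sup>2 + 2 * \<alpha>)"] r by (intro integrable_mult_right) simp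
  show "AE t in lborel. integrable M (\<lambda>\<omega>. case (t, \<omega>) of (t, \<omega>) \<Rightarrow> indicator {0..} t * exp (- r * t) * (Y t \<omega>)\<^sup>2)"
  proof (rule AE_I2)
    fix t :: real
    show "integrable M (\<lambda>\<omega>. case (t, \<omega>) of (t, \<omega>) \<Rightarrow> indicator {0..} t * exp (- r * t) * (Y t \<omega>)\<^sup>2)"
      using square_integrableD[OF second_moment_Y(1)[of t]] by (cases "0 \<le> t") auto
  qed
qed

end

section \<open>Truncation and stopping values\<close>

text \<open>
  For a continuous path the infimum in the hitting time is attained.
\<close>

lemma hitting_time_le_iff:
  assumes y: "continuous_on {0..} (\<lambda>t. Y t \<omega>)" and s: "0 \<le> s"
  shows "hitting_time Y C \<omega> \<le> ennreal s \<longleftrightarrow> (\<exists>u\<in>{0..s}. C \<le> Y u \<omega>)"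
proof
  assume "\<exists>u\<in>{0..s}. C \<le> Y u \<omega>"
  then obtain u where u: "0 \<le> u" "u \<le> s" "C \<le> Y u \<omega>" by auto
  then have "hitting_time Y C \<omega> \<le> ennreal u"
    unfolding hitting_time_def by (intro Inf_lower) auto
  also have "\<dots> \<le> ennreal s" using u by (intro ennreal_leI)
  finally show "hitting_time Y C \<omega> \<le> ennreal s" .
next
  assume le: "hitting_time Y C \<omega> \<le> ennreal s"
  show "\<exists>u\<in>{0..s}. C \<le> Y u \<omega>"
  proof (rule ccontr)
    assume "\<not> ?thesis"
    then have below: "Y u \<omega> < C" if "0 \<le> u" "u \<le> s" for u using that by force
    \<comment> \<open>by continuity at \<open>s\<close> the path stays below the level for a while after \<open>s\<close>\<close>
    obtain d where d: "0 < d" "\<And>u. 0 \<le> u \<Longrightarrow> \<bar>u - s\<bar> < d \<Longrightarrow> \<bar>Y u \<omega> - Y s \<omega>\<bar> < C - Y s \<omega>"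
      using y[unfolded continuous_on_iff, rule_format, of s "C - Y s \<omega>"] below[OF s order_refl] s
      by (auto simp: dist_real_def)
    have "ennreal (s + d) \<le> hitting_time Y C \<omega>"
      unfolding hitting_time_def
    proof (rule Inf_greatest)
      fix a assume "a \<in> {ennreal t |t. 0 \<le> t \<and> C \<le> Y t \<omega>}"
      then obtain t where t: "a = ennreal t" "0 \<le> t" "C \<le> Y t \<omega>" by auto
      have "s + d \<le> t"
      proof (rule ccontr)
        assume "\<not> s + d \<le> t"
        then consider "t \<le> s" | "\<bar>t - s\<bar> < d" by linarith
        then show False
        proof cases
          case 1
          then show False using below[OF t(2)] t(3) by simp
        next
          case 2
          then show False using d(2)[OF t(2) 2] t(3) by linarith
        qed
      qed
      then show "ennreal (s + d) \<le> a" unfolding t(1) by (rule ennreal_leI)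
    qed
    also note le
    finally show False using s d(1) by simp
  qed
qed

text \<open>
  Rational fractions of \<open>s\<close> replace rational times so that one countable set of parameters serves all
  \<open>s\<close> simultaneously; the set \<open>{(s, \<omega>). \<nu>\<^sub>C(\<omega>) \<le> s}\<close> thereby becomes jointly measurable.
\<close>

lemma reaches_level_iff_rational:
  fixes y :: "real \<Rightarrow> real"
  assumes y: "continuous_on {0..} y" and s: "0 \<le> s"
  shows "(\<exists>u\<in>{0..s}. C \<le> y u) \<longleftrightarrow> (\<forall>n::nat. \<exists>q\<in>\<rat> \<inter> {0..1}. C - 1 / real (Suc n) < y (q * s))"
proof
  assume "\<exists>u\<in>{0..s}. C \<le> y u"
  then obtain u where u: "0 \<le> u" "u \<le> s" "C \<le> y u" by auto
  define v where "v = (if s = 0 then 0 else u / s)"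
  have v: "0 \<le> v" "v \<le> 1" "v * s = u" using u s by (auto simp: v_def)
  show "\<forall>n::nat. \<exists>q\<in>\<rat> \<inter> {0..1}. C - 1 / real (Suc n) < y (q * s)"
  proof
    fix n :: nat
    have "continuous_on {0..1} (\<lambda>q. y (q * s))"
      using s by (intro continuous_on_compose2[OF y] continuous_intros) auto
    then obtain d where d: "0 < d"
      "\<And>q. q \<in> {0..1} \<Longrightarrow> \<bar>q - v\<bar> < d \<Longrightarrow> \<bar>y (q * s) - y (v * s)\<bar> < 1 / real (Suc n)"
      using v unfolding continuous_on_iff dist_real_def
      by (metis atLeastAtMost_iff of_nat_0_less_iff zero_less_Suc zero_less_divide_1_iff)
    obtain q where q: "q \<in> \<rat>" "max 0 (v - d) < q" "q < min 1 (v + d)"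
      using Rats_dense_in_real[of "max 0 (v - d)" "min 1 (v + d)"] v d(1) by auto
    then have "\<bar>y (q * s) - y (v * s)\<bar> < 1 / real (Suc n)" by (intro d(2)) auto
    then have "C - 1 / real (Suc n) < y (q * s)" using u(3) v(3) by simp
    then show "\<exists>q\<in>\<rat> \<inter> {0..1}. C - 1 / real (Suc n) < y (q * s)" using q by auto
  qed
next
  assume near: "\<forall>n::nat. \<exists>q\<in>\<rat> \<inter> {0..1}. C - 1 / real (Suc n) < y (q * s)"
  have "continuous_on {0..s} y" by (rule continuous_on_subset[OF y]) auto
  then obtain u where u: "u \<in> {0..s}" "\<And>t. t \<in> {0..s} \<Longrightarrow> y t \<le> y u"
    using continuous_attains_sup[of "{0..s}" y] s by auto
  have "C \<le> y u"
  proof (rule ccontr)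
    assume "\<not> C \<le> y u"
    then obtain n where n: "1 / real (Suc n) < C - y u" using nat_approx_posE[of "C - y u"] by auto
    obtain q where q: "0 \<le> q" "q \<le> 1" "C - 1 / real (Suc n) < y (q * s)" using near[rule_format, of n] by auto
    have "q * s \<in> {0..s}" using q s by (auto simp: mult_left_le_one_le)
    then show False using u(2)[of "q * s"] q(3) n by linarith
  qed
  then show "\<exists>u\<in>{0..s}. C \<le> y u" using u(1) by blast
qed

lemma truncated_eventually_eq:
  assumes y: "continuous_on {0..} (\<lambda>t. Y t \<omega>)" and s: "0 \<le> s"
  shows "\<forall>\<^sub>F C in at_top. truncated Y C s \<omega> = Y s \<omega>"
proof -
  have "continuous_on {0..s} (\<lambda>t. Y t \<omega>)" by (rule continuous_on_subset[OF y]) auto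
  then obtain u where u: "\<forall>t\<in>{0..s}. Y t \<omega> \<le> Y u \<omega>"
    using continuous_attains_sup[of "{0..s}" "\<lambda>t. Y t \<omega>"] s by auto
  show ?thesis
    using eventually_gt_at_top[of "Y u \<omega>"]
  proof eventually_elim
    case (elim C)
    then have "\<not> hitting_time Y C \<omega> \<le> ennreal s"
      unfolding hitting_time_le_iff[where Y=Y, OF y s] using u by force
    then show ?case by (simp add: truncated_def not_le)
  qed
qed

text \<open>
  Needed because the payoff of \<open>X\<close> itself, with its possibly discontinuous paths on a null set, must be
  shown measurable.
\<close>

lemma (in complete_measure) borel_measurable_AE_eq:
  fixes f g :: "'a \<Rightarrow> real"
  assumes f: "f \<in> borel_measurable M" and ae: "AE x in M. f x = g x"
  shows "g \<in> borel_measurable M"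
proof (rule measurableI)
  fix A :: "real set" assume "A \<in> sets borel"
  then have A: "f -` A \<inter> space M \<in> sets M" using f by (intro measurable_sets)
  have "AE x in M. x \<in> f -` A \<inter> space M \<longleftrightarrow> x \<in> g -` A \<inter> space M"
    using ae by eventually_elim simp
  then show "g -` A \<inter> space M \<in> sets M"
    using A by (rule in_sets_AE) simp
qed simp

lemma SUP_perturbation:
  fixes a b :: "'t \<Rightarrow> real"
  assumes "\<And>\<tau>. \<tau> \<in> S \<Longrightarrow> \<bar>a \<tau> - b \<tau>\<bar> \<le> e"
  shows "(SUP \<tau>\<in>S. ereal (a \<tau>)) \<le> (SUP \<tau>\<in>S. ereal (b \<tau>)) + ereal e"
proof (rule SUP_least)
  fix \<tau> assume \<tau>: "\<tau> \<in> S"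
  have "ereal (a \<tau>) \<le> ereal (b \<tau>) + ereal e" using assms[OF \<tau>] by simp
  also have "\<dots> \<le> (SUP \<tau>\<in>S. ereal (b \<tau>)) + ereal e" by (intro add_right_mono SUP_upper \<tau>)
  finally show "ereal (a \<tau>) \<le> (SUP \<tau>\<in>S. ereal (b \<tau>)) + ereal e" .
qed

lemma SUP_uniform_limit:
  fixes a :: "real \<Rightarrow> 't \<Rightarrow> real" and b :: "'t \<Rightarrow> real" and e :: "real \<Rightarrow> real"
  assumes S: "S \<noteq> {}" and b: "\<And>\<tau>. \<tau> \<in> S \<Longrightarrow> \<bar>b \<tau>\<bar> \<le> B"
    and ab: "\<And>C \<tau>. \<tau> \<in> S \<Longrightarrow> \<bar>a C \<tau> - b \<tau>\<bar> \<le> e C" and e: "(e \<longlongrightarrow> 0) at_top"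
  shows "((\<lambda>C. SUP \<tau>\<in>S. ereal (a C \<tau>)) \<longlongrightarrow> (SUP \<tau>\<in>S. ereal (b \<tau>))) at_top"
proof -
  let ?V = "SUP \<tau>\<in>S. ereal (b \<tau>)"
  obtain \<tau> where \<tau>: "\<tau> \<in> S" using S by blast
  have "?V \<le> ereal B" using b by (intro SUP_least) (force dest: abs_le_D1)
  moreover have "ereal (b \<tau>) \<le> ?V" by (rule SUP_upper[OF \<tau>])
  ultimately obtain v where v: "?V = ereal v" by (cases ?V) auto
  have ba: "\<bar>b \<tau> - a C \<tau>\<bar> \<le> e C" if "\<tau> \<in> S" for C \<tau>
    using ab[OF that] by (simp add: abs_minus_commute)
  have up: "(SUP \<tau>\<in>S. ereal (a C \<tau>)) \<le> ereal (v + e C)" for C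
    using SUP_perturbation[of S "a C" b "e C"] ab v by simp
  have low: "ereal (v - e C) \<le> (SUP \<tau>\<in>S. ereal (a C \<tau>))" for C
  proof -
    have "ereal v \<le> (SUP \<tau>\<in>S. ereal (a C \<tau>)) + ereal (e C)"
      using SUP_perturbation[of S b "a C" "e C"] ba v by simp
    then show ?thesis by (cases "SUP \<tau>\<in>S. ereal (a C \<tau>)") auto
  qed
  have "((\<lambda>C. ereal (v - e C)) \<longlongrightarrow> ereal (v - 0)) at_top" "((\<lambda>C. ereal (v + e C)) \<longlongrightarrow> ereal (v + 0)) at_top"
    by (intro tendsto_intros e)+
  then show ?thesis
    unfolding v using tendsto_sandwich[of "\<lambda>C. ereal (v - e C)" "\<lambda>C. SUP \<tau>\<in>S. ereal (a C \<tau>)" at_top "\<lambda>C. ereal (v + e C)"] low up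
    by simp
qed

context complete_filtered_prob_space
begin

lemma stopping_time_measurable: "stopping_time F \<tau> \<Longrightarrow> \<tau> \<in> borel_measurable M"
  using subalgebra_F by (elim measurable_stopping_time) (auto simp: subalgebra_def)

lemma stopped_indicator_measurable:
  fixes \<tau> :: "'a \<Rightarrow> ennreal"
  assumes "\<tau> \<in> borel_measurable M"
  shows "(\<lambda>z. indicator {s. 0 \<le> s \<and> ennreal s \<le> \<tau> (snd z)} (fst z) :: real)
    \<in> borel_measurable ((lborel :: real measure) \<Otimes>\<^sub>M M)"
proof -
  note [measurable] = assms
  show ?thesis unfolding indicator_def of_bool_def mem_Collect_eq by measurable
qed

definition reward :: "real \<Rightarrow> (real \<Rightarrow> real) \<Rightarrow> (real \<Rightarrow> 'a \<Rightarrow> real) \<Rightarrow> real \<times> 'a \<Rightarrow> real" where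
  "reward r P Z = (\<lambda>(s, \<omega>). indicator {0..} s * (exp (- r * s) * P (Z s \<omega>)))"

definition payoff :: "real \<Rightarrow> (real \<Rightarrow> real) \<Rightarrow> (real \<Rightarrow> 'a \<Rightarrow> real) \<Rightarrow> ('a \<Rightarrow> ennreal) \<Rightarrow> 'a \<Rightarrow> real" where
  "payoff r P Z \<tau> \<omega> = (LINT s:{s. 0 \<le> s \<and> ennreal s \<le> \<tau> \<omega>}|lborel. exp (- r * s) * P (Z s \<omega>))"

lemma
  assumes int: "integrable (lborel \<Otimes>\<^sub>M M) (reward r P Z)" and \<tau>: "stopping_time F \<tau>"
  shows stopped_reward_integrable:
      "integrable (lborel \<Otimes>\<^sub>M M) (\<lambda>z. indicator {s. 0 \<le> s \<and> ennreal s \<le> \<tau> (snd z)} (fst z) * reward r P Z z)"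
    and payoff_measurable: "payoff r P Z \<tau> \<in> borel_measurable M"
    and expected_payoff: "(\<integral>\<omega>. payoff r P Z \<tau> \<omega> \<partial>M) =
      (\<integral>z. indicator {s. 0 \<le> s \<and> ennreal s \<le> \<tau> (snd z)} (fst z) * reward r P Z z \<partial>(lborel \<Otimes>\<^sub>M M))"
proof -
  let ?g = "\<lambda>z. indicator {s. 0 \<le> s \<and> ennreal s \<le> \<tau> (snd z)} (fst z) * reward r P Z z"
  have [measurable]: "(\<lambda>z. indicator {s. 0 \<le> s \<and> ennreal s \<le> \<tau> (snd z)} (fst z) :: real) \<in> borel_measurable (lborel \<Otimes>\<^sub>M M)"
    by (rule stopped_indicator_measurable[OF stopping_time_measurable[OF \<tau>]])
  show *: "integrable (lborel \<Otimes>\<^sub>M M) ?g"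
    by (rule Bochner_Integration.integrable_bound[OF int])
       (use int in \<open>auto split: split_indicator\<close>)
  have p: "payoff r P Z \<tau> = (\<lambda>\<omega>. \<integral>s. ?g (s, \<omega>) \<partial>lborel)"
    unfolding payoff_def set_lebesgue_integral_def
    by (intro ext Bochner_Integration.integral_cong) (auto simp: reward_def split: split_indicator)
  show "payoff r P Z \<tau> \<in> borel_measurable M"
    unfolding p using time.integrable_snd[of "curry ?g"] * by simp
  show "(\<integral>\<omega>. payoff r P Z \<tau> \<omega> \<partial>M) = integral\<^sup>L (lborel \<Otimes>\<^sub>M M) ?g"
    unfolding p using time.integral_snd[of "curry ?g"] * by simp
qed

lemma expected_payoff_diff_le:
  assumes Y: "integrable (lborel \<Otimes>\<^sub>M M) (reward r P Y)" and Z: "integrable (lborel \<Otimes>\<^sub>M M) (reward r P Z)"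
    and \<tau>: "stopping_time F \<tau>"
  shows "\<bar>(\<integral>\<omega>. payoff r P Y \<tau> \<omega> \<partial>M) - (\<integral>\<omega>. payoff r P Z \<tau> \<omega> \<partial>M)\<bar>
      \<le> (\<integral>z. \<bar>reward r P Y z - reward r P Z z\<bar> \<partial>(lborel \<Otimes>\<^sub>M M))"
proof -
  let ?i = "\<lambda>z. indicator {s. 0 \<le> s \<and> ennreal s \<le> \<tau> (snd z)} (fst z) :: real"
  note iY = stopped_reward_integrable[OF Y \<tau>] and iZ = stopped_reward_integrable[OF Z \<tau>]
  have diff: "(\<integral>\<omega>. payoff r P Y \<tau> \<omega> \<partial>M) - (\<integral>\<omega>. payoff r P Z \<tau> \<omega> \<partial>M)
      = (\<integral>z. ?i z * reward r P Y z - ?i z * reward r P Z z \<partial>(lborel \<Otimes>\<^sub>M M))"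
    unfolding expected_payoff[OF Y \<tau>] expected_payoff[OF Z \<tau>]
    by (rule Bochner_Integration.integral_diff[OF iY iZ, symmetric])
  show ?thesis
    unfolding diff
    by (rule order_trans[OF integral_abs_bound integral_mono])
       (use iY iZ Y Z in \<open>auto split: split_indicator\<close>)
qed

lemma expected_payoff_abs_le:
  assumes Y: "integrable (lborel \<Otimes>\<^sub>M M) (reward r P Y)" and \<tau>: "stopping_time F \<tau>"
  shows "\<bar>\<integral>\<omega>. payoff r P Y \<tau> \<omega> \<partial>M\<bar> \<le> (\<integral>z. \<bar>reward r P Y z\<bar> \<partial>(lborel \<Otimes>\<^sub>M M))"
  unfolding expected_payoff[OF Y \<tau>]
  by (rule order_trans[OF integral_abs_bound integral_mono])
     (use stopped_reward_integrable[OF Y \<tau>] Y in \<open>auto split: split_indicator\<close>)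

lemma stopping_value_payoff:
  "stopping_value M F r P Z = (SUP \<tau>\<in>{\<tau>. stopping_time F \<tau>}. ereal (\<integral>\<omega>. payoff r P Z \<tau> \<omega> \<partial>M))"
  by (simp add: stopping_value_def payoff_def)

text \<open>
  Allows replacing \<open>X\<close> by its continuous version; completeness provides the measurability of the
  payoff of \<open>Z\<close>, which a null set of arbitrary paths could otherwise destroy.
\<close>

lemma stopping_value_cong_AE:
  assumes Y: "integrable (lborel \<Otimes>\<^sub>M M) (reward r P Y)"
    and ae: "AE \<omega> in M. \<forall>s\<ge>0. Y s \<omega> = Z s \<omega>"
  shows "stopping_value M F r P Z = stopping_value M F r P Y"
  unfolding stopping_value_payoff
proof (intro SUP_cong refl)
  fix \<tau> assume "\<tau> \<in> {\<tau>. stopping_time F \<tau>}"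
  then have \<tau>: "stopping_time F \<tau>" by simp
  have eq: "AE \<omega> in M. payoff r P Y \<tau> \<omega> = payoff r P Z \<tau> \<omega>"
    using ae
  proof eventually_elim
    case (elim \<omega>)
    then show ?case
      unfolding payoff_def set_lebesgue_integral_def
      by (intro Bochner_Integration.integral_cong) (auto split: split_indicator)
  qed
  note m = payoff_measurable[OF Y \<tau>]
  show "ereal (\<integral>\<omega>. payoff r P Z \<tau> \<omega> \<partial>M) = ereal (\<integral>\<omega>. payoff r P Y \<tau> \<omega> \<partial>M)"
    using integral_cong_AE[OF m borel_measurable_AE_eq[OF m eq] eq] by simp
qed

end

lemma truncated_cong:
  assumes "\<forall>t\<ge>0. Y t \<omega> = X t \<omega>" "0 \<le> s"
  shows "truncated Y C s \<omega> = truncated X C s \<omega>"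
proof -
  have "hitting_time Y C \<omega> = hitting_time X C \<omega>"
    unfolding hitting_time_def by (rule arg_cong[where f = Inf]) (use assms in auto)
  then show ?thesis using assms by (simp add: truncated_def)
qed

context geometric_brownian
begin

text \<open>
  Covers both \<open>Y\<close> and its truncations, which are dominated by \<open>\<bar>Y\<bar>\<close>.
\<close>

lemma profit_reward_integrable:
  assumes r: "0 < r" "\<sigma>\<^sup>2 + 2 * \<alpha> < r"
    and Zm: "(\<lambda>(t, \<omega>). indicator {0..} t * Z t \<omega>) \<in> borel_measurable (lborel \<Otimes>\<^sub>M M)"
    and Z: "\<And>t \<omega>. 0 \<le> t \<Longrightarrow> \<bar>Z t \<omega>\<bar> \<le> \<bar>Y t \<omega>\<bar>"
  shows "integrable (lborel \<Otimes>\<^sub>M M) (reward r (profit \<gamma> K) Z)"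
proof (rule Bochner_Integration.integrable_bound)
  let ?f = "\<lambda>z. (\<gamma>\<^sup>2 / 4) * (case z of (t, \<omega>) \<Rightarrow> indicator {0..} t * exp (- r * t) * (Y t \<omega>)\<^sup>2)
      + \<bar>K\<bar> * (case z of (t, \<omega>) \<Rightarrow> (indicator {0..} t * exp (- r * t)) * 1)"
  show "integrable (lborel \<Otimes>\<^sub>M M) ?f"
    by (intro Bochner_Integration.integrable_add integrable_mult_right discounted_square_integrable r(2)
        time.integrable_pair_mult integrable_exp_Ici r(1)) simp
  have eq: "reward r (profit \<gamma> K) Z = (\<lambda>z. indicator {0..} (fst z) * (exp (- r * fst z) *
      profit \<gamma> K ((\<lambda>(t, \<omega>). indicator {0..} t * Z t \<omega>) z)))"
    by (auto simp: reward_def fun_eq_iff split: split_indicator)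
  show "reward r (profit \<gamma> K) Z \<in> borel_measurable (lborel \<Otimes>\<^sub>M M)"
    using Zm unfolding eq profit_def by measurable
  show "AE z in lborel \<Otimes>\<^sub>M M. norm (reward r (profit \<gamma> K) Z z) \<le> norm (?f z)"
  proof (rule AE_I2)
    fix z :: "real \<times> 'a"
    obtain t \<omega> where z: "z = (t, \<omega>)" by (cases z)
    show "norm (reward r (profit \<gamma> K) Z z) \<le> norm (?f z)"
    proof (cases "0 \<le> t")
      case True
      have "(Z t \<omega>)\<^sup>2 \<le> (Y t \<omega>)\<^sup>2" using Z[OF True] by (rule abs_le_square_iff[THEN iffD1])
      then have le: "\<gamma>\<^sup>2 / 4 * (Z t \<omega>)\<^sup>2 \<le> \<gamma>\<^sup>2 / 4 * (Y t \<omega>)\<^sup>2" by (intro mult_left_mono) auto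
      have "0 \<le> \<gamma>\<^sup>2 / 4 * (Z t \<omega>)\<^sup>2" by simp
      moreover have "\<bar>a - K\<bar> \<le> b + \<bar>K\<bar>" if "0 \<le> a" "a \<le> b" for a b using that by arith
      ultimately have "\<bar>profit \<gamma> K (Z t \<omega>)\<bar> \<le> \<gamma>\<^sup>2 / 4 * (Y t \<omega>)\<^sup>2 + \<bar>K\<bar>"
        using le unfolding profit_def times_divide_eq_left by blast
      then have "exp (- r * t) * \<bar>profit \<gamma> K (Z t \<omega>)\<bar> \<le> exp (- r * t) * (\<gamma>\<^sup>2 / 4 * (Y t \<omega>)\<^sup>2 + \<bar>K\<bar>)"
        by (intro mult_left_mono) auto
      also have "\<dots> = ?f z" using True by (simp add: z algebra_simps)
      finally have "norm (reward r (profit \<gamma> K) Z z) \<le> ?f z"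
        using True by (simp add: z reward_def abs_mult)
      then show ?thesis by simp
    qed (simp add: z reward_def)
  qed
qed

lemma truncated_measurable:
  "(\<lambda>(t, \<omega>). indicator {0..} t * truncated Y C t \<omega>) \<in> borel_measurable (lborel \<Otimes>\<^sub>M M)"
proof -
  let ?L = "lborel :: real measure"
  have Yq: "(\<lambda>z. Y (q * fst z) (snd z)) \<in> borel_measurable (?L \<Otimes>\<^sub>M M)" for q
  proof -
    have "(\<lambda>z. (q * fst z, snd z)) \<in> ?L \<Otimes>\<^sub>M M \<rightarrow>\<^sub>M ?L \<Otimes>\<^sub>M M" by simp
    from measurable_compose[OF this Y_measurable] show ?thesis by simp
  qed
  note [measurable] = Yq[of 1, simplified]
  define R where "R = \<rat> \<inter> {0..1 :: real}"
  have R: "countable R" by (simp add: R_def countable_Int1 countable_rat)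
  define Q where "Q z \<longleftrightarrow> (\<forall>n::nat. \<exists>q\<in>R. C - 1 / real (Suc n) < Y (q * fst z) (snd z))" for z
  have "Measurable.pred (?L \<Otimes>\<^sub>M M) (\<lambda>z. C - 1 / real (Suc n) < Y (q * fst z) (snd z))" for n q
    using Yq[of q] by measurable
  then have [measurable]: "Measurable.pred (?L \<Otimes>\<^sub>M M) Q"
    unfolding Q_def[abs_def]
    using R by (intro pred_intros_countable pred_intros_countable_bounded) auto
  have "(\<lambda>(t, \<omega>). indicator {0..} t * truncated Y C t \<omega>)
      = (\<lambda>z. indicator {0..} (fst z) * (if Q z then 0 else Y (fst z) (snd z)))"
  proof (intro ext, clarify)
    fix t \<omega>
    show "indicator {0..} t * truncated Y C t \<omega>
        = indicator {0..} (fst (t, \<omega>)) * (if Q (t, \<omega>) then 0 else Y (fst (t, \<omega>)) (snd (t, \<omega>)))"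
    proof (cases "0 \<le> t")
      case True
      have "ennreal t < hitting_time Y C \<omega> \<longleftrightarrow> \<not> Q (t, \<omega>)"
        unfolding not_le[symmetric] hitting_time_le_iff[where Y=Y, OF Y_continuous True]
          reaches_level_iff_rational[OF Y_continuous True] R_def Q_def fst_conv snd_conv ..
      then show ?thesis by (simp add: truncated_def)
    qed simp
  qed
  then show ?thesis by simp
qed

text \<open>
  Truncation turns the reward of \<open>Y\<close> either into itself or into that of the zero path, which dominates
  the difference; the rest is dominated convergence and the uniformity in the stopping time.
\<close>

lemma truncated_values_tendsto:
  assumes r: "0 < r" "\<sigma>\<^sup>2 + 2 * \<alpha> < r"
  shows "((\<lambda>C. stopping_value M F r (profit \<gamma> K) (truncated X C))
           \<longlongrightarrow> stopping_value M F r (profit \<gamma> K) X) at_top"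
proof -
  let ?P = "profit \<gamma> K"
  let ?f = "reward r ?P Y" and ?g = "\<lambda>C. reward r ?P (truncated Y C)"
  have f: "integrable (lborel \<Otimes>\<^sub>M M) ?f"
    by (rule profit_reward_integrable[OF r]) (use Y_measurable in \<open>simp_all add: split_beta'\<close>)
  have g: "integrable (lborel \<Otimes>\<^sub>M M) (?g C)" for C
    by (rule profit_reward_integrable[OF r truncated_measurable]) (simp add: truncated_def)
  have VX: "stopping_value M F r ?P X = stopping_value M F r ?P Y"
    by (rule stopping_value_cong_AE[OF f AE_Y_eq])
  have VT: "stopping_value M F r ?P (truncated X C) = stopping_value M F r ?P (truncated Y C)" for C
  proof (rule stopping_value_cong_AE[OF g])
    show "AE \<omega> in M. \<forall>s\<ge>0. truncated Y C s \<omega> = truncated X C s \<omega>"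
      using AE_Y_eq by eventually_elim (simp add: truncated_cong)
  qed
  let ?w = "\<lambda>z. 2 * \<bar>?f z\<bar> + 2 * \<bar>reward r (\<lambda>_. profit \<gamma> K 0) Y z\<bar>"
  have w: "integrable (lborel \<Otimes>\<^sub>M M) ?w"
  proof -
    have "integrable (lborel \<Otimes>\<^sub>M M) (\<lambda>(t, \<omega>). (indicator {0..} t * exp (- r * t)) * profit \<gamma> K 0)"
      by (intro time.integrable_pair_mult integrable_exp_Ici r) simp
    then have "integrable (lborel \<Otimes>\<^sub>M M) (reward r (\<lambda>_. profit \<gamma> K 0) Y)"
      by (simp add: reward_def mult.assoc)
    then show ?thesis using f by simp
  qed
  define e where "e C = (\<integral>z. \<bar>?g C z - ?f z\<bar> \<partial>(lborel \<Otimes>\<^sub>M M))" for C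
  have "((\<lambda>C. \<integral>z. \<bar>?g C z - ?f z\<bar> \<partial>(lborel \<Otimes>\<^sub>M M)) \<longlongrightarrow> (\<integral>z. 0 \<partial>((lborel :: real measure) \<Otimes>\<^sub>M M))) at_top"
  proof (rule integral_dominated_convergence_at_top[OF _ _ w])
    show "(\<lambda>z. \<bar>?g C z - ?f z\<bar>) \<in> borel_measurable (lborel \<Otimes>\<^sub>M M)" for C
      using f g[of C] by measurable
    show "AE z in lborel \<Otimes>\<^sub>M M. ((\<lambda>C. \<bar>?g C z - ?f z\<bar>) \<longlongrightarrow> 0) at_top"
    proof (intro AE_I2 tendsto_eventually)
      fix z :: "real \<times> 'a"
      obtain s \<omega> where z: "z = (s, \<omega>)" by (cases z)
      show "\<forall>\<^sub>F C in at_top. \<bar>?g C z - ?f z\<bar> = 0"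
      proof (cases "0 \<le> s")
        case True
        show ?thesis
          using truncated_eventually_eq[where Y=Y, OF Y_continuous True, of \<omega>]
          by eventually_elim (simp add: z reward_def)
      qed (simp add: z reward_def)
    qed
    have "norm \<bar>?g C z - ?f z\<bar> \<le> ?w z" for C z
    proof (cases z)
      case (Pair s \<omega>)
      show ?thesis
        by (cases "ennreal s < hitting_time Y C \<omega>") (auto simp: Pair reward_def truncated_def)
    qed
    then show "\<forall>\<^sub>F C in at_top. AE z in lborel \<Otimes>\<^sub>M M. norm \<bar>?g C z - ?f z\<bar> \<le> ?w z" by simp
  qed simp
  then have e0: "(e \<longlongrightarrow> 0) at_top" by (simp add: e_def[abs_def])
  show ?thesis
    unfolding VX VT unfolding stopping_value_payoff
  proof (rule SUP_uniform_limit[OF _ _ _ e0])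
    show "{\<tau>. stopping_time F \<tau>} \<noteq> {}" using stopping_time_const by blast
    show "\<bar>\<integral>\<omega>. payoff r ?P Y \<tau> \<omega> \<partial>M\<bar> \<le> (\<integral>z. \<bar>?f z\<bar> \<partial>(lborel \<Otimes>\<^sub>M M))"
      if "\<tau> \<in> {\<tau>. stopping_time F \<tau>}" for \<tau>
      using that by (intro expected_payoff_abs_le f) simp
    show "\<bar>(\<integral>\<omega>. payoff r ?P (truncated Y C) \<tau> \<omega> \<partial>M) - (\<integral>\<omega>. payoff r ?P Y \<tau> \<omega> \<partial>M)\<bar> \<le> e C"
      if "\<tau> \<in> {\<tau>. stopping_time F \<tau>}" for C \<tau>
      unfolding e_def using that by (intro expected_payoff_diff_le f g) simp
  qed
qed

end

theorem proposition3:
  fixes M :: "'a measure" and F :: "ennreal \<Rightarrow> 'a measure"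
    and W :: "real \<Rightarrow> 'a \<Rightarrow> real" and X :: "real \<Rightarrow> real \<Rightarrow> 'a \<Rightarrow> real"
    and \<alpha> \<sigma> \<gamma> r K :: real
  assumes "\<sigma> > 0" and "\<gamma> > 0" and "r > 0" and "K > 0" and "r > \<sigma>\<^sup>2 + 2 * \<alpha>"
    and "complete_filtered_prob_space M F"
    and "brownian_motion M F W"
    and "\<And>x. x \<ge> 0 \<Longrightarrow> geometric_brownian_motion M F W \<alpha> \<sigma> x (X x)"
  shows "\<forall>x\<ge>0. ((\<lambda>C. stopping_value M F r (profit \<gamma> K) (truncated (X x) C))
           \<longlongrightarrow> stopping_value M F r (profit \<gamma> K) (X x)) at_top"
proof (intro allI impI)
  fix x :: real assume "0 \<le> x"
  then have "geometric_brownian M F W \<alpha> \<sigma> x (X x)"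
    using assms
    by (simp add: geometric_brownian_def brownian_filtration_def brownian_filtration_axioms_def
        geometric_brownian_axioms_def)
  then interpret geometric_brownian M F W \<alpha> \<sigma> x "X x" .
  show "((\<lambda>C. stopping_value M F r (profit \<gamma> K) (truncated (X x) C))
           \<longlongrightarrow> stopping_value M F r (profit \<gamma> K) (X x)) at_top"
    using assms by (intro truncated_values_tendsto) auto
qed

end
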